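(* Let $\kappa \le 0$, let $X$ be a CBB$(\kappa)$ space, let $Y$ be a complete CAT$(\kappa)$ space and let $A \subseteq X$ be nonempty. Then the multivalued mapping $\Phi_c : \mathcal{N}(A,Y) \to \mathcal{P}(\mathcal{N}(X,Y))$, assigning to each $f\in\mathcal{N}(A,Y)$ the set of all $f'\in\mathcal{N}(X,Y)$ with $f'|_A=f$ and $f'(X)\subseteq\overline{\mathrm{co}}(f(A))$, is lower semi-continuous.
   Context: For $\kappa\le0$, a geodesic space is CAT$(\kappa)$ (resp. CBB$(\kappa)$) if every geodesic triangle satisfies $\le$ (resp. $\ge$) when comparing distances between points on it with distances between corresponding points of its comparison triangle in the model surface $M^2_\kappa$. $\mathcal{N}(A,Y)$ is the set of bounded nonexpansive maps $A\to Y$ with the supremum metric $d_\infty$. For $C\subseteq Y$, $G_1(C)$ is the union of all geodesic segments with endpoints in $C$, $G_n(C)=G_1(G_{n-1}(C))$, $\mathrm{co}(C)=\bigcup_n G_n(C)$, $\overline{\mathrm{co}}(C)$ its closure. A multivalued map $\Gamma:U\to\mathcal{P}(Z)$ is lower semi-continuous if $\{u:\Gamma(u)\cap V\neq\emptyset\}$ is open for every open $V$. *)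

theory Defs
  imports "HOL-Analysis.Analysis"
begin

definition geodesic :: "(real \<Rightarrow> 'a::metric_space) \<Rightarrow> 'a \<Rightarrow> 'a \<Rightarrow> bool" where
  "geodesic \<gamma> x y \<longleftrightarrow> \<gamma> 0 = x \<and> \<gamma> (dist x y) = y \<and>
     (\<forall>s\<in>{0..dist x y}. \<forall>t\<in>{0..dist x y}. dist (\<gamma> s) (\<gamma> t) = \<bar>s - t\<bar>)"

definition geodesic_space :: "'a::metric_space set \<Rightarrow> bool" where
  "geodesic_space S \<longleftrightarrow>
     (\<forall>x\<in>S. \<forall>y\<in>S. \<exists>\<gamma>. geodesic \<gamma> x y \<and> \<gamma> ` {0..dist x y} \<subseteq> S)"

text \<open>For kappa = 0 the Euclidean plane (complex numbers); for kappa < 0 the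
  Poincare disc model of the hyperbolic plane rescaled to curvature kappa.\<close>
definition model_space :: "real \<Rightarrow> complex set" where
  "model_space \<kappa> = (if \<kappa> = 0 then UNIV else ball 0 1)"

definition model_dist :: "real \<Rightarrow> complex \<Rightarrow> complex \<Rightarrow> real" where
  "model_dist \<kappa> u v =
     (if \<kappa> = 0 then cmod (u - v)
      else arcosh (1 + 2 * (cmod (u - v))\<^sup>2 / ((1 - (cmod u)\<^sup>2) * (1 - (cmod v)\<^sup>2))) / sqrt (- \<kappa>))"

text \<open>A geodesic triangle in S is given by vertices x y z and chosen geodesic sides
  g1 (x to y), g2 (y to z), g3 (z to x) lying in S. A comparison triangle consists of
  points xb yb zb of the model space with the same side lengths. The comparison point of
  the point g s on a side from a to b (0 \<le> s \<le> d(a,b)) is the point m of the model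
  with distance s from ab and d(a,b) - s from bb, i.e. the point of the (unique) model
  geodesic [ab,bb] at distance s from ab. R is the comparison relation between the
  distance in S and the distance of the comparison points.\<close>
definition comparison_holds :: "(real \<Rightarrow> real \<Rightarrow> bool) \<Rightarrow> real \<Rightarrow> 'a::metric_space set \<Rightarrow> bool" where
  "comparison_holds R \<kappa> S \<longleftrightarrow>
    (\<forall>x\<in>S. \<forall>y\<in>S. \<forall>z\<in>S. \<forall>g1 g2 g3.
       geodesic g1 x y \<and> g1 ` {0..dist x y} \<subseteq> S \<and>
       geodesic g2 y z \<and> g2 ` {0..dist y z} \<subseteq> S \<and>
       geodesic g3 z x \<and> g3 ` {0..dist z x} \<subseteq> S \<longrightarrow>
       (\<forall>xb\<in>model_space \<kappa>. \<forall>yb\<in>model_space \<kappa>. \<forall>zb\<in>model_space \<kappa>.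
          model_dist \<kappa> xb yb = dist x y \<and> model_dist \<kappa> yb zb = dist y z \<and>
          model_dist \<kappa> zb xb = dist z x \<longrightarrow>
          (\<forall>(g, a, b, ab, bb) \<in> {(g1, x, y, xb, yb), (g2, y, z, yb, zb), (g3, z, x, zb, xb)}.
           \<forall>(g', a', b', ab', bb') \<in> {(g1, x, y, xb, yb), (g2, y, z, yb, zb), (g3, z, x, zb, xb)}.
           \<forall>s\<in>{0..dist a b}. \<forall>t\<in>{0..dist a' b'}.
           \<forall>m\<in>model_space \<kappa>. \<forall>m'\<in>model_space \<kappa>.
             model_dist \<kappa> ab m = s \<and> model_dist \<kappa> m bb = dist a b - s \<and>
             model_dist \<kappa> ab' m' = t \<and> model_dist \<kappa> m' bb' = dist a' b' - t \<longrightarrow>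
             R (dist (g s) (g' t)) (model_dist \<kappa> m m'))))"

definition CAT :: "real \<Rightarrow> 'a::metric_space set \<Rightarrow> bool" where
  "CAT \<kappa> S \<longleftrightarrow> geodesic_space S \<and> comparison_holds (\<lambda>d dm. d \<le> dm) \<kappa> S"

definition CBB :: "real \<Rightarrow> 'a::metric_space set \<Rightarrow> bool" where
  "CBB \<kappa> S \<longleftrightarrow> geodesic_space S \<and> comparison_holds (\<lambda>d dm. d \<ge> dm) \<kappa> S"

definition G1 :: "'a::metric_space set \<Rightarrow> 'a set" where
  "G1 C = {p. \<exists>x\<in>C. \<exists>y\<in>C. \<exists>\<gamma>. geodesic \<gamma> x y \<and> p \<in> \<gamma> ` {0..dist x y}}"

definition geo_co :: "'a::metric_space set \<Rightarrow> 'a set" where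
  "geo_co C = (\<Union>n. (G1 ^^ Suc n) C)"

definition nonexp_maps :: "'a::metric_space set \<Rightarrow> ('a \<Rightarrow> 'b::metric_space) set" where
  "nonexp_maps A = {f. (\<forall>x\<in>A. \<forall>y\<in>A. dist (f x) (f y) \<le> dist x y) \<and> bounded (f ` A) \<and>
                        (\<forall>x. x \<notin> A \<longrightarrow> f x = undefined)}"

definition sup_dist :: "'a set \<Rightarrow> ('a \<Rightarrow> 'b::metric_space) \<Rightarrow> ('a \<Rightarrow> 'b) \<Rightarrow> real" where
  "sup_dist A f g = (SUP x\<in>A. dist (f x) (g x))"

definition N_open :: "'a::metric_space set \<Rightarrow> ('a \<Rightarrow> 'b::metric_space) set \<Rightarrow> bool" where
  "N_open A U \<longleftrightarrow> U \<subseteq> nonexp_maps A \<and>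
     (\<forall>f\<in>U. \<exists>e>0. \<forall>g\<in>nonexp_maps A. sup_dist A f g < e \<longrightarrow> g \<in> U)"

definition lsc_multimap :: "('u set \<Rightarrow> bool) \<Rightarrow> ('z set \<Rightarrow> bool) \<Rightarrow> 'u set \<Rightarrow> ('u \<Rightarrow> 'z set) \<Rightarrow> bool" where
  "lsc_multimap openU openZ U \<Gamma> \<longleftrightarrow> (\<forall>V. openZ V \<longrightarrow> openU {u\<in>U. \<Gamma> u \<inter> V \<noteq> {}})"

definition Phi_c :: "'a::metric_space set \<Rightarrow> ('a \<Rightarrow> 'b::metric_space) \<Rightarrow> ('a \<Rightarrow> 'b) set" where
  "Phi_c A f = {f' \<in> nonexp_maps UNIV. (\<forall>a\<in>A. f' a = f a) \<and> range f' \<subseteq> closure (geo_co (f ` A))}"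

end

theory Submission
  imports Defs
begin

text \<open>Given an extension \<open>F\<close> of \<open>f\<close> and a map \<open>g\<close> close to \<open>f\<close>, an extension \<open>G\<close> of \<open>g\<close> close to
  \<open>F\<close> is found by a Kirszbraun argument. First compose \<open>F\<close> with the nearest point projection onto the closed
  convex hull of \<open>g(A)\<close>; this moves it little, since the hull of \<open>f(A)\<close> lies in a small neighbourhood of the
  hull of \<open>g(A)\<close>, which is convex. Put the new \<open>F\<close> on a copy of \<open>X\<close> at height \<open>h\<close> over \<open>X\<close>. As
  \<open>F\<close> is bounded and \<open>g\<close> is close to \<open>f\<close>, the map given by \<open>g\<close> on \<open>A\<close> and by \<open>F\<close> on the copy is
  nonexpansive, and a nonexpansive extension to \<open>X\<close> stays within \<open>h\<close> of \<open>F\<close>.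

  Extending by one point \<open>x\<close> amounts to intersecting balls in \<open>Y\<close>. By a minimax principle this reduces
  to a weighted average of the conditions, which holds at a barycenter: the variance inequality in \<open>Y\<close> bounds the
  average from above by pairwise distances, and the Lang--Schroeder--Sturm inequality in \<open>X\<close> bounds
  the corresponding average at \<open>x\<close> from below. The latter is proved by shrinking the configuration towards
  \<open>x\<close> and merging two of its points into their midpoint, with an error of smaller order.\<close>

subsection \<open>Comparison in the model planes\<close>

text \<open>\<open>Y\<close> need not be locally compact and infinitely many balls must be met at
  once, so uniform strong convexity has to do the work of compactness. In \<open>X\<close> no linear
  tangent space at \<open>x\<close> is available in which the averaged kernel would be a Gram form.
  Instead, the kernel of the two merged points, divided by \<open>t\<^sup>2\<close>, is a monotone
  bounded function \<open>h\<close>, and the merging error at scale \<open>t\<close> is at most a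
  constant times \<open>t\<^sup>2 * (h (3 * t) - h t)\<close>. The form itself scales like
  \<open>t\<^sup>2\<close>, and the differences vanish along \<open>T / 3 ^ n\<close>.

  The copy of \<open>X\<close> at a height is never built as a space, so no curvature bound for a
  product has to be proved. The height only multiplies weights of the upper layer by
  \<open>1 + q * \<eta>\<close>, and the inequality for points of \<open>X\<close> is enough. The
  projection comes first because the values of the given extension lie in the hull of
  \<open>f(A)\<close>, whereas the balls are intersected inside the hull of
  \<open>g(A)\<close>.\<close>

text \<open>Throughout, \<open>q = - \<kappa>\<close>. The generalised sine \<open>sn\<close> and the modified distance \<open>md\<close>, an
  antiderivative of \<open>sn\<close>, satisfy the same polynomial identities in the flat and the hyperbolic case, with
  \<open>1 + q * md q\<close> as generalised cosine.\<close>

definition md :: "real \<Rightarrow> real \<Rightarrow> real" where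
  "md q s = (if q = 0 then s\<^sup>2 / 2 else (cosh (sqrt q * s) - 1) / q)"

definition sn :: "real \<Rightarrow> real \<Rightarrow> real" where
  "sn q s = (if q = 0 then s else sinh (sqrt q * s) / sqrt q)"

lemma md_0 [simp]: "md q 0 = 0"
  by (simp add: md_def)

lemma sn_0 [simp]: "sn q 0 = 0"
  by (simp add: sn_def)

lemma one_plus_md: "1 + q * md q s = cosh (sqrt q * s)"
  by (simp add: md_def)

lemma md_add:
  assumes "q \<ge> 0"
  shows "md q (a + b) = md q a + md q b + q * md q a * md q b + sn q a * sn q b"
proof (cases "q = 0")
  case True
  then show ?thesis by (simp add: md_def sn_def power2_eq_square field_simps)
next
  case False
  with assms have q: "q > 0" by simp
  have "1 + q * md q (a + b) = (1 + q * md q a) * (1 + q * md q b) + q * (sn q a * sn q b)"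
    using q by (simp add: one_plus_md ring_distribs cosh_add sn_def)
  then have "q * md q (a + b) = q * (md q a + md q b + q * md q a * md q b + sn q a * sn q b)"
    by (simp add: algebra_simps)
  then show ?thesis using q by simp
qed

lemma sn_minus: "sn q (- s) = - sn q s"
  by (simp add: sn_def)

lemma md_minus: "md q (- s) = md q s"
  by (simp add: md_def)

lemma md_diff:
  assumes "q \<ge> 0"
  shows "md q (a - b) = md q a + md q b + q * md q a * md q b - sn q a * sn q b"
  using md_add[OF assms, of a "- b"] by (simp add: sn_minus md_minus)

lemma sn_square:
  assumes "q \<ge> 0"
  shows "(sn q s)\<^sup>2 = 2 * md q s + q * (md q s)\<^sup>2"
  using md_diff[OF assms, of s s] by (simp add: power2_eq_square)

lemma md_double:
  assumes "q \<ge> 0"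
  shows "md q (2 * s) = 4 * md q s + 2 * q * (md q s)\<^sup>2"
  using md_add[OF assms, of s s] sn_square[OF assms, of s] by (simp add: power2_eq_square)

lemma sn_double:
  assumes "q \<ge> 0"
  shows "sn q (2 * s) = 2 * (1 + q * md q s) * sn q s"
proof (cases "q = 0")
  case False
  have "sinh (sqrt q * (2 * s)) = 2 * sinh (sqrt q * s) * cosh (sqrt q * s)"
    using sinh_double[of "sqrt q * s"] by (simp add: algebra_simps)
  then show ?thesis using False by (simp add: one_plus_md sn_def)
qed (simp add: sn_def)

lemma sn_strict_mono:
  assumes "q \<ge> 0" "a < b"
  shows "sn q a < sn q b"
  using assms by (auto simp: sn_def divide_strict_right_mono)

lemma sn_mono:
  assumes "q \<ge> 0" "a \<le> b"
  shows "sn q a \<le> sn q b"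
  using sn_strict_mono[OF assms(1), of a b] assms(2) by (cases "a = b") auto

lemma sn_pos: "q \<ge> 0 \<Longrightarrow> s > 0 \<Longrightarrow> sn q s > 0"
  using sn_strict_mono[of q 0 s] by simp

lemma sn_nonneg: "q \<ge> 0 \<Longrightarrow> s \<ge> 0 \<Longrightarrow> sn q s \<ge> 0"
  using sn_mono[of q 0 s] by simp

lemma md_nonneg: "q \<ge> 0 \<Longrightarrow> md q s \<ge> 0"
  using cosh_real_ge_1[of "sqrt q * s"] by (simp add: md_def)

lemma md_strict_mono:
  assumes "q \<ge> 0" "0 \<le> a" "a < b"
  shows "md q a < md q b"
proof (cases "q = 0")
  case True
  then show ?thesis using assms by (simp add: md_def power_strict_mono)
next
  case False
  then have "q > 0" using assms by simp
  then have "cosh (sqrt q * a) < cosh (sqrt q * b)"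
    using assms by (subst cosh_real_nonneg_less_iff) auto
  then show ?thesis using \<open>q > 0\<close> by (simp add: md_def divide_strict_right_mono)
qed

lemma md_mono:
  assumes "q \<ge> 0" "0 \<le> a" "a \<le> b"
  shows "md q a \<le> md q b"
  using md_strict_mono[OF assms(1,2), of b] assms(3) by (cases "a = b") auto

lemma md_le_iff:
  assumes "q \<ge> 0" "0 \<le> a" "0 \<le> b"
  shows "md q a \<le> md q b \<longleftrightarrow> a \<le> b"
  using md_strict_mono[OF assms(1,3), of a] md_mono[OF assms(1,2), of b] by fastforce

lemma md_abs: "md q \<bar>s\<bar> = md q s"
  by (cases "s \<ge> 0") (auto simp: md_minus)

lemma sn_ge_self:
  assumes "q \<ge> 0" "s \<ge> 0"
  shows "s \<le> sn q s"
proof (cases "q = 0")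
  case True
  then show ?thesis by (simp add: sn_def)
next
  case False
  with assms have q: "sqrt q > 0" by simp
  have "sqrt q * s \<le> sinh (sqrt q * s)"
  proof -
    have "sinh 0 - 0 \<le> sinh (sqrt q * s) - sqrt q * s"
    proof (rule DERIV_nonneg_imp_nondecreasing[of 0 "sqrt q * s" "\<lambda>x. sinh x - x"])
      show "0 \<le> sqrt q * s" using assms q by simp
      fix x :: real
      show "\<exists>y. ((\<lambda>x. sinh x - x) has_real_derivative y) (at x) \<and> 0 \<le> y"
        by (rule exI[of _ "cosh x - 1"]) (auto intro!: derivative_eq_intros cosh_real_ge_1)
    qed
    then show ?thesis by simp
  qed
  then show ?thesis using False q by (simp add: sn_def field_simps)
qed

lemma md_ge_square:
  assumes "q \<ge> 0"
  shows "s\<^sup>2 / 2 \<le> md q s"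
proof -
  have "\<bar>s\<bar> / 2 \<le> sn q (\<bar>s\<bar> / 2)"
    using sn_ge_self[OF assms, of "\<bar>s\<bar> / 2"] by simp
  then have "(\<bar>s\<bar> / 2)\<^sup>2 \<le> (sn q (\<bar>s\<bar> / 2))\<^sup>2"
    by (rule power_mono) simp
  then have "s\<^sup>2 \<le> 2 * md q (2 * (\<bar>s\<bar> / 2))"
    unfolding md_double[OF assms] sn_square[OF assms] by (simp add: power_divide field_simps)
  then show ?thesis by (simp add: md_abs)
qed

lemma isCont_md: "isCont (md q) s"
  unfolding md_def by (cases "q = 0") (auto intro!: continuous_intros)

lemma continuous_on_md [continuous_intros]:
  "continuous_on S f \<Longrightarrow> continuous_on S (\<lambda>x. md q (f x))"
  by (rule continuous_on_compose2[of UNIV "md q"]) (auto simp: continuous_on_eq_continuous_at isCont_md)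

lemma sn_surj:
  assumes "q \<ge> 0" "w \<ge> 0"
  obtains u where "u \<ge> 0" "sn q u = w"
proof -
  have "isCont (sn q) x" for x
    unfolding sn_def by (cases "q = 0") (auto intro!: continuous_intros)
  then have "\<exists>u. 0 \<le> u \<and> u \<le> w \<and> sn q u = w"
    using assms sn_ge_self[OF assms] by (intro IVT) auto
  then show ?thesis using that by blast
qed

text \<open>In the model plane, \<open>apex q x u p\<close> is \<open>sn |xu| * sn |xp| * cos \<alpha>\<close> with \<open>\<alpha>\<close> the angle at \<open>x\<close>, by the
  law of cosines.\<close>

definition apex :: "real \<Rightarrow> 'a::metric_space \<Rightarrow> 'a \<Rightarrow> 'a \<Rightarrow> real" where
  "apex q x u p = md q (dist x u) + md q (dist x p) + q * md q (dist x u) * md q (dist x p) - md q (dist u p)"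

section \<open>Explicit comparison triangles in the disc and the plane\<close>

lemma one_minus_tanh_square: "1 - (tanh x)\<^sup>2 = 1 / (cosh x)\<^sup>2" for x :: real
proof -
  have "(cosh x)\<^sup>2 \<noteq> 0" by simp
  then show ?thesis
    using cosh_square_eq[of x] by (simp add: tanh_def power_divide diff_divide_eq_iff field_simps)
qed

text \<open>The points \<open>tanh (u / 2)\<close> run along a diameter of the disc, a geodesic, at
  unit speed for curvature -1. A comparison side placed there has distances that are differences of
  parameters.\<close>

lemma model_dist_real:
  fixes u v :: real
  assumes "\<kappa> < 0"
  shows "model_dist \<kappa> (of_real (tanh (u / 2))) (of_real (tanh (v / 2))) = \<bar>u - v\<bar> / sqrt (- \<kappa>)"
proof -
  have c: "cosh x \<noteq> 0" for x :: real by simp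
  have "tanh (u/2) - tanh (v/2) = sinh ((u - v) / 2) / (cosh (u/2) * cosh (v/2))"
  proof -
    have "sinh ((u - v) / 2) = sinh (u/2) * cosh (v/2) - cosh (u/2) * sinh (v/2)"
      by (simp add: diff_divide_distrib sinh_diff)
    then show ?thesis
      using c[of "u/2"] c[of "v/2"] by (simp add: tanh_def diff_frac_eq mult.commute)
  qed
  then have "1 + 2 * (tanh (u/2) - tanh (v/2))\<^sup>2 / ((1 - (tanh (u/2))\<^sup>2) * (1 - (tanh (v/2))\<^sup>2)) = 1 + 2 * (sinh ((u - v)/2))\<^sup>2"
    unfolding one_minus_tanh_square by (simp only: power_divide power_mult_distrib) (simp add: c)
  also have "\<dots> = cosh (2 * ((u - v) / 2))"
    unfolding cosh_double_cosh by (simp add: cosh_square_eq)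
  also have "2 * ((u - v) / 2) = u - v" by simp
  also have "cosh (u - v) = cosh \<bar>u - v\<bar>" by simp
  finally have "1 + 2 * (cmod (of_real (tanh (u/2)) - of_real (tanh (v/2))))\<^sup>2 /
       ((1 - (cmod (of_real (tanh (u/2))))\<^sup>2) * (1 - (cmod (of_real (tanh (v/2))))\<^sup>2)) = cosh \<bar>u - v\<bar>"
    by (simp flip: of_real_diff)
  then have "arcosh (1 + 2 * (cmod (of_real (tanh (u/2)) - of_real (tanh (v/2))))\<^sup>2 /
       ((1 - (cmod (of_real (tanh (u/2))))\<^sup>2) * (1 - (cmod (of_real (tanh (v/2))))\<^sup>2))) = \<bar>u - v\<bar>"
    by (simp only: arcosh_cosh_real abs_ge_zero)
  then show ?thesis using assms by (simp only: model_dist_def) simp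
qed

text \<open>\<open>(T, Z)\<close> are the hyperboloid coordinates of the point \<open>Z / (1 + T)\<close> of the disc.\<close>

lemma model_dist_hyperboloid:
  fixes u T :: real and Z :: complex
  assumes "\<kappa> < 0" "T \<ge> 1" "(cmod Z)\<^sup>2 = T\<^sup>2 - 1"
  shows "cosh (sqrt (- \<kappa>) * model_dist \<kappa> (of_real (tanh (u / 2))) (Z / of_real (1 + T)))
           = T * cosh u - Re Z * sinh u" (is ?A)
    and "model_dist \<kappa> (of_real (tanh (u / 2))) (Z / of_real (1 + T)) \<ge> 0" (is ?B)
    and "Z / of_real (1 + T) \<in> ball 0 1" (is ?C)
proof -
  define z where "z = Z / of_real (1 + T)"
  define r where "r = tanh (u / 2)"
  have T: "1 + T > 0" using assms by simp
  have z2: "(cmod z)\<^sup>2 = (T - 1) / (T + 1)"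
  proof -
    have "(cmod z)\<^sup>2 = (cmod Z)\<^sup>2 / (1 + T)\<^sup>2"
      using T by (simp add: z_def norm_divide power_divide del: of_real_add)
    also have "\<dots> = ((T - 1) * (T + 1)) / ((T + 1) * (T + 1))"
      unfolding assms(3) by (simp add: power2_eq_square algebra_simps)
    finally show ?thesis using T by simp
  qed
  then have z1: "1 - (cmod z)\<^sup>2 = 2 / (1 + T)" using T by (simp add: field_simps)
  have r1: "1 - r\<^sup>2 = 1 / (cosh (u / 2))\<^sup>2"
    unfolding r_def by (rule one_minus_tanh_square)
  have "(cmod (of_real r - z))\<^sup>2 = r\<^sup>2 - 2 * r * Re z + (cmod z)\<^sup>2"
    unfolding cmod_power2 by (simp add: power2_eq_square algebra_simps)
  also have "Re z = Re Z / (1 + T)" unfolding z_def Re_divide_of_real ..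
  finally have rz: "(cmod (of_real r - z))\<^sup>2 = (r\<^sup>2 * (1 + T) - 2 * r * Re Z + (T - 1)) / (1 + T)"
    using T by (simp add: z2 add_divide_distrib diff_divide_distrib add.commute[of T])
  have cu: "cosh u = (cosh (u/2))\<^sup>2 + (sinh (u/2))\<^sup>2" "sinh u = 2 * sinh (u/2) * cosh (u/2)"
    using cosh_double[of "u/2"] sinh_double[of "u/2"] by simp_all
  have sc: "(sinh (u/2))\<^sup>2 = (cosh (u/2))\<^sup>2 - 1" by (simp add: cosh_square_eq)
  have "1 + 2 * (cmod (of_real r - z))\<^sup>2 / ((1 - r\<^sup>2) * (1 - (cmod z)\<^sup>2))
      = 1 + (cosh (u/2))\<^sup>2 * (r\<^sup>2 * (1 + T) - 2 * r * Re Z + (T - 1))"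
  proof -
    have "1 + 2 * (N / S) / (1 / C * (2 / S)) = 1 + C * N" if "S > 0" for N S C :: real
      using that by simp
    from this[OF T] show ?thesis unfolding rz z1 r1 .
  qed
  also have "\<dots> = 1 + (sinh (u/2))\<^sup>2 * (1 + T) - 2 * sinh (u/2) * cosh (u/2) * Re Z + (cosh (u/2))\<^sup>2 * (T - 1)"
    by (simp add: r_def tanh_def field_simps power2_eq_square)
  also have "\<dots> = T * cosh u - Re Z * sinh u"
    unfolding cu sc by (simp add: algebra_simps)
  finally have eq: "1 + 2 * (cmod (of_real r - z))\<^sup>2 / ((1 - r\<^sup>2) * (1 - (cmod z)\<^sup>2)) = T * cosh u - Re Z * sinh u" .
  have "0 \<le> 2 * (cmod (of_real r - z))\<^sup>2 / ((1 - r\<^sup>2) * (1 - (cmod z)\<^sup>2))"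
    unfolding z1 r1 using T by simp
  then have ge: "T * cosh u - Re Z * sinh u \<ge> 1" using eq by linarith
  have md: "sqrt (- \<kappa>) * model_dist \<kappa> (of_real r) z = arcosh (T * cosh u - Re Z * sinh u)"
    using assms(1) eq by (simp add: model_dist_def)
  show ?A using md ge unfolding r_def z_def by simp
  have "0 \<le> sqrt (- \<kappa>) * model_dist \<kappa> (of_real r) z"
    unfolding md using ge by simp
  then show ?B unfolding r_def z_def using assms(1) by (simp add: zero_le_mult_iff)
  have "(cmod z)\<^sup>2 < 1" using z1 T by (smt (verit) divide_pos_pos)
  then have "cmod z < 1" by (simp add: power_less_one_iff abs_square_less_1)
  then show ?C by (simp add: z_def)
qed

text \<open>One side lies on the real axis, and the law of cosines fixes the coordinate
  \<open>X\<close> of the third vertex along it: Cartesian in the plane, a hyperboloid coordinate in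
  the disc. The triangle inequalities bound the modulus of \<open>X\<close> by \<open>a\<close>,
  respectively \<open>sinh (k * a)\<close>, so the other coordinate is a real square root. The last
  conclusion expresses, with denominators cleared, that \<open>yb\<close> and \<open>m\<close> are
  seen from \<open>xb\<close> in the same direction.\<close>

lemma comparison_configuration:
  assumes q: "q \<ge> 0" and l: "0 < l" and s: "0 \<le> s" "s \<le> l"
    and tri: "l \<le> a + b" "a \<le> l + b" "b \<le> l + a"
  obtains xb yb zb m where
    "xb \<in> model_space (- q)" "yb \<in> model_space (- q)" "zb \<in> model_space (- q)" "m \<in> model_space (- q)"
    "model_dist (- q) xb yb = l" "model_dist (- q) yb zb = b" "model_dist (- q) zb xb = a"
    "model_dist (- q) xb m = s" "model_dist (- q) m yb = l - s" "model_dist (- q) zb zb = 0"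
    "model_dist (- q) m zb \<ge> 0"
    "sn q l * (md q s + md q a + q * md q s * md q a - md q (model_dist (- q) m zb))
      = sn q s * (md q l + md q a + q * md q l * md q a - md q b)"
proof (cases "q = 0")
  case True
  define X where "X = (a\<^sup>2 + l\<^sup>2 - b\<^sup>2) / (2 * l)"
  have a: "a \<ge> 0" "b \<ge> 0" using tri by auto
  have Xl: "2 * l * X = a\<^sup>2 + l\<^sup>2 - b\<^sup>2" using l by (simp add: X_def)
  have "\<bar>a - l\<bar> \<le> \<bar>b\<bar>" using tri a by auto
  then have "(a - l)\<^sup>2 \<le> b\<^sup>2" by (rule abs_le_square_iff[THEN iffD1])
  then have "2 * l * X \<le> 2 * l * a" unfolding Xl by (simp add: power2_eq_square algebra_simps)
  moreover have "b\<^sup>2 \<le> (a + l)\<^sup>2" using tri a by (intro power_mono) auto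
  then have "2 * l * (- a) \<le> 2 * l * X" unfolding Xl by (simp add: power2_eq_square algebra_simps)
  ultimately have "X \<le> a" "- a \<le> X" using l by (auto simp only: mult_le_cancel_left)
  then have "\<bar>X\<bar> \<le> \<bar>a\<bar>" by simp
  then have X: "X\<^sup>2 \<le> a\<^sup>2" by (rule abs_le_square_iff[THEN iffD1])
  define z where "z = Complex X (sqrt (a\<^sup>2 - X\<^sup>2))"
  have dz: "(cmod (z - of_real t))\<^sup>2 = a\<^sup>2 - 2 * t * X + t\<^sup>2" for t
    unfolding cmod_power2 using X by (simp add: z_def power2_eq_square algebra_simps)
  have za: "cmod z = a" using dz[of 0] a by simp
  have "(cmod (z - of_real l))\<^sup>2 = b\<^sup>2" unfolding dz using Xl by (simp add: algebra_simps)
  then have zl: "cmod (of_real l - z) = b" using a by (simp add: norm_minus_commute)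
  have ms: "md q (cmod (of_real s - z)) = (a\<^sup>2 - 2 * s * X + s\<^sup>2) / 2"
    using dz[of s] True by (simp add: md_def norm_minus_commute)
  show ?thesis
  proof (rule that[of 0 "of_real l" z "of_real s"])
    show "sn q l * (md q s + md q a + q * md q s * md q a - md q (model_dist (- q) (of_real s) z))
      = sn q s * (md q l + md q a + q * md q l * md q a - md q b)"
    proof -
      have b2: "b\<^sup>2 = a\<^sup>2 + l\<^sup>2 - 2 * l * X" using Xl by simp
      have "model_dist (- q) (of_real s) z = cmod (of_real s - z)"
        using True by (simp add: model_dist_def)
      then have "md q (model_dist (- q) (of_real s) z) = (a\<^sup>2 - 2 * s * X + s\<^sup>2) / 2"
        using ms by simp
      then show ?thesis
        using True by (simp add: sn_def md_def b2) (simp add: field_simps)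
    qed
  qed (use True za zl l s in \<open>auto simp: model_space_def model_dist_def simp flip: of_real_diff\<close>)
next
  case False
  with q have q': "q > 0" "- q < 0" by auto
  define k where "k = sqrt q"
  have k: "k > 0" using q' by (simp add: k_def)
  have kk: "sqrt (- (- q)) = k" by (simp add: k_def)
  define X where "X = (cosh (k * a) * cosh (k * l) - cosh (k * b)) / sinh (k * l)"
  have a: "a \<ge> 0" "b \<ge> 0" using tri by auto
  have shl: "sinh (k * l) > 0" using k l by simp
  have Xl: "X * sinh (k * l) = cosh (k * a) * cosh (k * l) - cosh (k * b)"
    using k l by (simp add: X_def)
  have "cosh (k * \<bar>a - l\<bar>) \<le> cosh (k * b)"
    using tri a k by (subst cosh_real_nonneg_le_iff) auto
  moreover have "cosh (k * \<bar>a - l\<bar>) = cosh (k * a - k * l)"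
  proof -
    have "k * \<bar>a - l\<bar> = \<bar>k * a - k * l\<bar>"
      using k by (simp add: abs_mult flip: right_diff_distrib)
    then show ?thesis by (simp only: cosh_real_abs)
  qed
  ultimately have "X * sinh (k * l) \<le> sinh (k * a) * sinh (k * l)"
    unfolding Xl by (simp add: cosh_diff)
  moreover have "cosh (k * b) \<le> cosh (k * (a + l))"
    using tri a k l by (subst cosh_real_nonneg_le_iff) auto
  then have "- sinh (k * a) * sinh (k * l) \<le> X * sinh (k * l)"
    unfolding Xl by (simp add: ring_distribs cosh_add)
  ultimately have "\<bar>X\<bar> \<le> \<bar>sinh (k * a)\<bar>"
    using shl k a by (auto simp only: mult_le_cancel_right)
  then have X: "X\<^sup>2 \<le> (sinh (k * a))\<^sup>2" by (rule abs_le_square_iff[THEN iffD1])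
  define Z where "Z = Complex X (sqrt ((sinh (k * a))\<^sup>2 - X\<^sup>2))"
  have ReZ: "Re Z = X" by (simp add: Z_def)
  have Z2: "(cmod Z)\<^sup>2 = (cosh (k * a))\<^sup>2 - 1"
    using X by (simp add: Z_def cmod_power2 cosh_square_eq)
  have T1: "cosh (k * a) \<ge> 1" by (rule cosh_real_ge_1)
  define z where "z = Z / of_real (1 + cosh (k * a))"
  define pt where "pt u = (of_real (tanh (k * u / 2)) :: complex)" for u
  note hyp = model_dist_hyperboloid(1,2)[OF q'(2) T1 Z2, folded z_def, of "k * u" for u, folded pt_def,
      unfolded ReZ kk]
  have zb: "z \<in> ball 0 1" unfolding z_def by (rule model_dist_hyperboloid(3)[OF q'(2) T1 Z2])
  have zu: "z \<in> model_space (- q)" "pt u \<in> model_space (- q)" for u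
  proof -
    show "z \<in> model_space (- q)" using zb q' by (simp add: model_space_def)
    have "\<bar>tanh (k * u / 2)\<bar> < 1" using tanh_real_bounds[of "k * u / 2"] by auto
    then show "pt u \<in> model_space (- q)"
      using q' by (simp add: model_space_def pt_def)
  qed
  have ptd: "model_dist (- q) (pt u) (pt v) = \<bar>u - v\<bar>" for u v
  proof -
    have "model_dist (- q) (pt u) (pt v) = \<bar>k * u - k * v\<bar> / k"
      unfolding pt_def model_dist_real[OF q'(2)] kk ..
    also have "\<dots> = \<bar>k * (u - v)\<bar> / k" by (simp add: right_diff_distrib)
    also have "\<dots> = \<bar>u - v\<bar>" using k by (simp add: abs_mult)
    finally show ?thesis .
  qed
  have sym: "model_dist (- q) z (pt u) = model_dist (- q) (pt u) z" for u
    by (simp add: model_dist_def norm_minus_commute mult.commute)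
  have inj: "d = d'" if "cosh (k * d) = cosh (k * d')" "d \<ge> 0" "d' \<ge> 0" for d d'
  proof -
    have "k * d = k * d'" using that k
      by (metis arcosh_cosh_real mult_nonneg_nonneg less_imp_le)
    then show ?thesis using k by simp
  qed
  have a0: "model_dist (- q) (pt 0) z = a"
  proof (rule inj[OF _ hyp(2) a(1)])
    have "cosh (k * 0) = 1" "sinh (k * 0) = 0" by simp_all
    then show "cosh (k * model_dist (- q) (pt 0) z) = cosh (k * a)"
      using hyp(1)[of 0] by (simp only: mult_1_right mult_zero_right diff_zero)
  qed
  have b0: "model_dist (- q) (pt l) z = b"
  proof (rule inj[OF _ hyp(2) a(2)])
    show "cosh (k * model_dist (- q) (pt l) z) = cosh (k * b)"
      using hyp(1)[of l] Xl by linarith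
  qed
  show ?thesis
  proof (rule that[of "pt 0" "pt l" z "pt s"])
    define D where "D = model_dist (- q) (pt s) z"
    have D: "cosh (k * D) = cosh (k * a) * cosh (k * s) - X * sinh (k * s)"
      using hyp(1)[of s] by (simp add: D_def)
    have E: "md q u + md q a + q * md q u * md q a - md q v = (cosh (k * u) * cosh (k * a) - cosh (k * v)) / q" for u v
      using False by (simp add: md_def k_def[symmetric] field_simps)
    have "sinh (k * l) * (cosh (k * s) * cosh (k * a) - cosh (k * D)) = sinh (k * s) * (X * sinh (k * l))"
      unfolding D by (simp add: algebra_simps)
    also have "\<dots> = sinh (k * s) * (cosh (k * l) * cosh (k * a) - cosh (k * b))"
      unfolding Xl by (simp add: algebra_simps)
    finally show "sn q l * (md q s + md q a + q * md q s * md q a - md q (model_dist (- q) (pt s) z))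
      = sn q s * (md q l + md q a + q * md q l * md q a - md q b)"
      unfolding E D_def[symmetric] using False by (simp add: sn_def k_def[symmetric])
    show "model_dist (- q) z z = 0" using q' by (simp add: model_dist_def)
  qed (use zu ptd sym a0 b0 hyp(2) l s in simp_all)
qed

text \<open>The point \<open>p\<close> is the end of the side \<open>g2\<close>, so comparing points
  on two sides covers the comparison of \<open>p\<close> with \<open>\<gamma> s\<close>. Keeping
  \<open>R\<close> abstract serves both curvature bounds.\<close>

lemma comparison_apex:
  fixes x y p :: "'a::metric_space"
  assumes q: "q \<ge> 0" and sp: "geodesic_space (UNIV :: 'a set)"
    and R: "comparison_holds R (- q) (UNIV :: 'a set)"
    and g: "geodesic \<gamma> x y" and l: "0 < dist x y" and s: "0 \<le> s" "s \<le> dist x y"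
  obtains D where "R (dist (\<gamma> s) p) D" "D \<ge> 0"
    "sn q (dist x y) * (md q s + md q (dist x p) + q * md q s * md q (dist x p) - md q D)
      = sn q s * apex q x y p"
proof -
  have tri: "dist x y \<le> dist x p + dist y p" "dist x p \<le> dist x y + dist y p" "dist y p \<le> dist x y + dist x p"
    by metric+
  from comparison_configuration[OF q l s tri] obtain xb yb zb m where M:
    "xb \<in> model_space (- q)" "yb \<in> model_space (- q)" "zb \<in> model_space (- q)" "m \<in> model_space (- q)"
    "model_dist (- q) xb yb = dist x y" "model_dist (- q) yb zb = dist y p" "model_dist (- q) zb xb = dist p x"
    "model_dist (- q) xb m = s" "model_dist (- q) m yb = dist x y - s" "model_dist (- q) zb zb = 0"
    "model_dist (- q) m zb \<ge> 0"
    "sn q (dist x y) * (md q s + md q (dist x p) + q * md q s * md q (dist x p) - md q (model_dist (- q) m zb))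
      = sn q s * (md q (dist x y) + md q (dist x p) + q * md q (dist x y) * md q (dist x p) - md q (dist y p))"
    unfolding dist_commute[of x p] by blast
  obtain g2 where g2: "geodesic g2 y p" using sp unfolding geodesic_space_def by blast
  obtain g3 where g3: "geodesic g3 p x" using sp unfolding geodesic_space_def by blast
  note R = R[unfolded comparison_holds_def, THEN bspec, OF UNIV_I[of x], THEN bspec, OF UNIV_I[of y],
      THEN bspec, OF UNIV_I[of p], THEN spec[of _ \<gamma>], THEN spec[of _ g2], THEN spec[of _ g3]]
  note R = mp[OF R, OF conjI[OF g conjI[OF subset_UNIV conjI[OF g2 conjI[OF subset_UNIV conjI[OF g3 subset_UNIV]]]]],
      THEN bspec, OF M(1), THEN bspec, OF M(2), THEN bspec, OF M(3)]
  note R = mp[OF R, OF conjI[OF M(5) conjI[OF M(6,7)]]]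
  have "R (dist (\<gamma> s) (g2 (dist y p))) (model_dist (- q) m zb)"
    using R M s by (simp add: dist_commute)
  moreover have "g2 (dist y p) = p" using g2 by (simp add: geodesic_def)
  ultimately show ?thesis using that M(11,12) by (simp add: apex_def)
qed

subsection \<open>Comparison in spaces of curvature bounded below or above\<close>

lemma apex_base [simp]: "apex q x x p = 0"
  by (simp add: apex_def)

lemma apex_commute: "apex q x u p = apex q x p u"
  by (simp add: apex_def dist_commute algebra_simps)

text \<open>The triangle inequality through \<open>x\<close> amounts to cos \<alpha> \<ge> -1. This
  keeps the rescaled kernel bounded below when configurations shrink to \<open>x\<close>.\<close>

lemma apex_ge:
  assumes "q \<ge> 0"
  shows "apex q x u p \<ge> - (sn q (dist x u) * sn q (dist x p))"
proof -
  have "dist u p \<le> dist x u + dist x p" by metric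
  then have "md q (dist u p) \<le> md q (dist x u + dist x p)"
    using assms by (intro md_mono) auto
  then show ?thesis by (simp add: apex_def md_add[OF assms])
qed

lemma geodesic_dist:
  assumes "geodesic \<gamma> x y" "0 \<le> s" "s \<le> dist x y"
  shows "dist x (\<gamma> s) = s" "dist (\<gamma> s) y = dist x y - s"
proof -
  have ends: "\<gamma> 0 = x" "\<gamma> (dist x y) = y" using assms(1) unfolding geodesic_def by auto
  have iso: "dist (\<gamma> a) (\<gamma> b) = \<bar>a - b\<bar>" if "a \<in> {0..dist x y}" "b \<in> {0..dist x y}" for a b
    using assms(1) that unfolding geodesic_def by blast
  have "dist (\<gamma> 0) (\<gamma> s) = \<bar>0 - s\<bar>" "dist (\<gamma> s) (\<gamma> (dist x y)) = \<bar>s - dist x y\<bar>"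
    using assms(2,3) by (simp_all add: iso)
  then show "dist x (\<gamma> s) = s" "dist (\<gamma> s) y = dist x y - s"
    using assms(2,3) unfolding ends by auto
qed

lemma CBB_geodesic: "CBB \<kappa> (UNIV :: 'a::metric_space set) \<Longrightarrow> \<exists>\<gamma>. geodesic \<gamma> (x::'a) y"
  unfolding CBB_def geodesic_space_def by blast

lemma CAT_geodesic: "CAT \<kappa> (UNIV :: 'a::metric_space set) \<Longrightarrow> \<exists>\<gamma>. geodesic \<gamma> (x::'a) y"
  unfolding CAT_def geodesic_space_def by blast

text \<open>Monotonicity of comparison angles: shortening a side at \<open>x\<close> can only
  increase the angle there. The product form makes sense also for sides of length zero.\<close>

lemma CBB_apex:
  fixes x y p :: "'a::metric_space"
  assumes q: "q \<ge> 0" and X: "CBB (- q) (UNIV :: 'a set)"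
    and g: "geodesic \<gamma> x y" and s: "0 \<le> s" "s \<le> dist x y"
  shows "sn q (dist x y) * apex q x (\<gamma> s) p \<le> sn q s * apex q x y p"
proof (cases "dist x y = 0")
  case True
  then show ?thesis using s by simp
next
  case False
  then have l: "0 < dist x y" by simp
  obtain D where D: "dist (\<gamma> s) p \<ge> D" "D \<ge> 0"
    "sn q (dist x y) * (md q s + md q (dist x p) + q * md q s * md q (dist x p) - md q D)
      = sn q s * apex q x y p"
    using comparison_apex[OF q _ _ g l s, of "\<lambda>d dm. d \<ge> dm" p] X unfolding CBB_def by blast
  have "md q D \<le> md q (dist (\<gamma> s) p)" using D q by (intro md_mono)
  then show ?thesis
    unfolding D(3)[symmetric] using q
    by (intro mult_left_mono sn_nonneg) (auto simp: apex_def geodesic_dist[OF g s])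
qed

lemma CAT_apex:
  fixes x y p :: "'a::metric_space"
  assumes q: "q \<ge> 0" and X: "CAT (- q) (UNIV :: 'a set)"
    and g: "geodesic \<gamma> x y" and s: "0 \<le> s" "s \<le> dist x y"
  shows "sn q s * apex q x y p \<le> sn q (dist x y) * apex q x (\<gamma> s) p"
proof (cases "dist x y = 0")
  case True
  then show ?thesis using s by simp
next
  case False
  then have l: "0 < dist x y" by simp
  obtain D where D: "dist (\<gamma> s) p \<le> D" "D \<ge> 0"
    "sn q (dist x y) * (md q s + md q (dist x p) + q * md q s * md q (dist x p) - md q D)
      = sn q s * apex q x y p"
    using comparison_apex[OF q _ _ g l s, of "\<lambda>d dm. d \<le> dm" p] X unfolding CAT_def by blast
  have "md q (dist (\<gamma> s) p) \<le> md q D" using D q by (intro md_mono) auto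
  then show ?thesis
    unfolding D(3)[symmetric] using q
    by (intro mult_left_mono sn_nonneg) (auto simp: apex_def geodesic_dist[OF g s])
qed

text \<open>Translates angle comparison into comparison of medians. Only the distance of
  \<open>m\<close> from \<open>x\<close> enters, so the identity also applies to a point known
  merely to be half as far from \<open>x\<close> as \<open>y\<close>.\<close>

lemma apex_midpoint:
  assumes q: "q \<ge> 0" and m: "dist x m = dist x y / 2"
  defines "e \<equiv> md q (dist x y / 2)"
  shows "apex q x y p - 2 * (1 + q * e) * apex q x m p =
    2 * (1 + q * e) * md q (dist m p) + 2 * e - (md q (dist x p) + md q (dist y p))"
proof -
  have L: "md q (dist x y) = 4 * e + 2 * q * e\<^sup>2"
    using md_double[OF q, of "dist x y / 2"] by (simp add: e_def)
  show ?thesis unfolding apex_def L m e_def[symmetric]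
    by (simp add: algebra_simps power2_eq_square)
qed

lemma CBB_midpoint:
  fixes x y p :: "'a::metric_space"
  assumes q: "q \<ge> 0" and X: "CBB (- q) (UNIV :: 'a set)" and g: "geodesic \<gamma> x y"
  defines "m \<equiv> \<gamma> (dist x y / 2)" and "e \<equiv> md q (dist x y / 2)"
  shows "md q (dist x p) + md q (dist y p) \<le> 2 * (1 + q * e) * md q (dist m p) + 2 * e"
proof (cases "dist x y = 0")
  case True
  then show ?thesis using g by (simp add: m_def e_def geodesic_def)
next
  case False
  then have pos: "sn q (dist x y / 2) > 0" using q by (intro sn_pos) auto
  have d: "sn q (dist x y) = 2 * (1 + q * e) * sn q (dist x y / 2)"
    using sn_double[OF q, of "dist x y / 2"] by (simp add: e_def)
  have "sn q (dist x y / 2) * (2 * (1 + q * e) * apex q x m p) \<le> sn q (dist x y / 2) * apex q x y p"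
    using CBB_apex[OF q X g, of "dist x y / 2" p] unfolding d m_def by (simp add: algebra_simps)
  then have "2 * (1 + q * e) * apex q x m p \<le> apex q x y p" using pos by simp
  moreover have "dist x m = dist x y / 2" unfolding m_def by (rule geodesic_dist[OF g]) auto
  ultimately show ?thesis using apex_midpoint[OF q, of x m y p] by (simp add: e_def)
qed

lemma CAT_midpoint:
  fixes x y p :: "'a::metric_space"
  assumes q: "q \<ge> 0" and X: "CAT (- q) (UNIV :: 'a set)" and g: "geodesic \<gamma> x y"
  defines "m \<equiv> \<gamma> (dist x y / 2)" and "e \<equiv> md q (dist x y / 2)"
  shows "2 * (1 + q * e) * md q (dist m p) + 2 * e \<le> md q (dist x p) + md q (dist y p)"
proof (cases "dist x y = 0")
  case True
  then show ?thesis using g by (simp add: m_def e_def geodesic_def)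
next
  case False
  then have pos: "sn q (dist x y / 2) > 0" using q by (intro sn_pos) auto
  have d: "sn q (dist x y) = 2 * (1 + q * e) * sn q (dist x y / 2)"
    using sn_double[OF q, of "dist x y / 2"] by (simp add: e_def)
  have "sn q (dist x y / 2) * apex q x y p \<le> sn q (dist x y / 2) * (2 * (1 + q * e) * apex q x m p)"
    using CAT_apex[OF q X g, of "dist x y / 2" p] unfolding d m_def by (simp add: algebra_simps)
  then have "apex q x y p \<le> 2 * (1 + q * e) * apex q x m p" using pos by simp
  moreover have "dist x m = dist x y / 2" unfolding m_def by (rule geodesic_dist[OF g]) auto
  ultimately show ?thesis using apex_midpoint[OF q, of x m y p] by (simp add: e_def)
qed

text \<open>A path towards \<open>p\<close> along which \<open>sn\<close> of the distance from \<open>x\<close> grows linearly, so that the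
  comparison kernel \<open>apex\<close>, divided by the parameter, is monotone.\<close>

definition scaled_path :: "real \<Rightarrow> 'a::metric_space \<Rightarrow> real \<Rightarrow> real \<Rightarrow> (real \<Rightarrow> 'a) \<Rightarrow> bool" where
  "scaled_path q x w T \<zeta> \<longleftrightarrow> (\<forall>t\<in>{0..T}. sn q (dist x (\<zeta> t)) = w * t) \<and>
     (\<forall>t\<in>{0..T}. \<forall>t'\<in>{0..T}. \<forall>z. t \<le> t' \<longrightarrow> t' * apex q x (\<zeta> t) z \<le> t * apex q x (\<zeta> t') z)"

text \<open>The speed \<open>c\<close> absorbs the weight of \<open>p\<close>: points of several
  such paths at time \<open>t\<close>, taken with weight one, have kernels at most
  \<open>t\<^sup>2\<close> times the weighted kernels of the endpoints. The bound
  \<open>c * T \<le> 1\<close> keeps the path on the geodesic.\<close>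

lemma scaled_path_exists:
  fixes x p :: "'a::metric_space"
  assumes q: "q \<ge> 0" and X: "CBB (- q) (UNIV :: 'a set)" and c: "c \<ge> 0" "c * T \<le> 1"
  obtains \<zeta> where "scaled_path q x (c * sn q (dist x p)) T \<zeta>"
    "\<And>t z. t \<in> {0..T} \<Longrightarrow> apex q x (\<zeta> t) z \<le> c * t * apex q x p z"
proof -
  obtain \<gamma> where g: "geodesic \<gamma> x p" using CBB_geodesic[OF X] by blast
  define w where "w = c * sn q (dist x p)"
  have w: "w \<ge> 0" using c q by (simp add: w_def sn_nonneg)
  have "\<forall>t\<in>{0..T}. \<exists>u. u \<ge> 0 \<and> sn q u = w * t"
    using sn_surj[OF q] w by (metis atLeastAtMost_iff mult_nonneg_nonneg)
  then obtain u where u: "\<And>t. t \<in> {0..T} \<Longrightarrow> u t \<ge> 0 \<and> sn q (u t) = w * t" by metis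
  have ur: "u t \<le> dist x p" if t: "t \<in> {0..T}" for t
  proof (rule ccontr)
    assume "\<not> u t \<le> dist x p"
    then have "sn q (dist x p) < w * t"
      using sn_strict_mono[OF q, of "dist x p" "u t"] u[OF t] by simp
    also have "\<dots> = (c * t) * sn q (dist x p)" by (simp add: w_def)
    also have "\<dots> \<le> 1 * sn q (dist x p)"
    proof (rule mult_right_mono)
      have "c * t \<le> c * T" using t c by (intro mult_left_mono) auto
      then show "c * t \<le> 1" using c by simp
    qed (use q in \<open>simp add: sn_nonneg\<close>)
    finally show False by simp
  qed
  define \<zeta> where "\<zeta> t = \<gamma> (u t)" for t
  have dz: "dist x (\<zeta> t) = u t" if "t \<in> {0..T}" for t
    unfolding \<zeta>_def using geodesic_dist(1)[OF g] u[OF that] ur[OF that] by blast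
  have mono: "t' * apex q x (\<zeta> t) z \<le> t * apex q x (\<zeta> t') z"
    if t: "t \<in> {0..T}" "t' \<in> {0..T}" "t \<le> t'" for t t' z
  proof (cases "w = 0")
    case True
    have "sn q (u t) = sn q 0" "sn q (u t') = sn q 0" using True u t by simp_all
    then have "u t = 0" "u t' = 0"
      using sn_pos[OF q] u[OF t(1)] u[OF t(2)] by (smt (verit) sn_0)+
    then have "\<zeta> t = x" "\<zeta> t' = x" using g by (simp_all add: \<zeta>_def geodesic_def)
    then show ?thesis by simp
  next
    case False
    have le: "u t \<le> u t'"
    proof (rule ccontr)
      assume "\<not> u t \<le> u t'"
      then have "sn q (u t') < sn q (u t)" by (intro sn_strict_mono q) auto
      then have "w * t' < w * t" using u t by simp
      then show False using w t by (simp add: mult_less_cancel_left)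
    qed
    have "geodesic \<gamma> x (\<zeta> t')"
      using g ur[OF t(2)] u[OF t(2)] unfolding geodesic_def dz[OF t(2)] by (auto simp: \<zeta>_def)
    then have "sn q (dist x (\<zeta> t')) * apex q x (\<gamma> (u t)) z \<le> sn q (u t) * apex q x (\<zeta> t') z"
      using u t le by (intro CBB_apex[OF q X]) (auto simp: dz)
    then have "w * (t' * apex q x (\<zeta> t) z) \<le> w * (t * apex q x (\<zeta> t') z)"
      using u[OF t(1)] u[OF t(2)] dz[OF t(2)] unfolding \<zeta>_def[symmetric] by (simp add: mult.assoc)
    then show ?thesis using False w by simp
  qed
  show ?thesis
  proof (rule that)
    show "scaled_path q x (c * sn q (dist x p)) T \<zeta>"
      using mono u dz unfolding scaled_path_def w_def[symmetric] by auto
    fix t z assume t: "t \<in> {0..T}"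
    show "apex q x (\<zeta> t) z \<le> c * t * apex q x p z"
    proof (cases "x = p")
      case True
      then have "u t = 0" using ur[OF t] u[OF t] by simp
      then have "\<zeta> t = x" using g by (simp add: \<zeta>_def geodesic_def)
      then show ?thesis using True by simp
    next
      case False
      then have pos: "sn q (dist x p) > 0" using q by (simp add: sn_pos)
      have "sn q (dist x p) * apex q x (\<gamma> (u t)) z \<le> sn q (u t) * apex q x p z"
        using u[OF t] ur[OF t] by (intro CBB_apex[OF q X g]) auto
      then have "sn q (dist x p) * apex q x (\<zeta> t) z \<le> sn q (dist x p) * (c * t * apex q x p z)"
        using u[OF t] by (simp add: \<zeta>_def w_def algebra_simps)
      then show ?thesis using pos by simp
    qed
  qed
qed

text \<open>In the use below, \<open>E1\<close>, \<open>E2\<close>, \<open>Eo\<close> belong to the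
  distances of \<open>x\<close> from the two points and from their midpoint \<open>m\<close>,
  \<open>Em\<close> and \<open>Ep\<close> to those of an auxiliary point \<open>z\<close> from
  \<open>m\<close> and from the first point, and \<open>e\<close> to half the distance of the two
  points. The hypotheses are a median bound at \<open>m\<close>, one at \<open>z\<close>, and an
  angle comparison; multiplying the first by \<open>2 * (1 + q * e)\<close> lets the second
  eliminate \<open>Em\<close>.\<close>

lemma merge_error_algebra:
  fixes q :: real
  assumes "q \<ge> 0" "e \<ge> 0"
    and "Eo + Em \<le> 2 * (1 + q * E2) * e + 2 * E2"
    and "Ep + E2 \<le> 2 * (1 + q * e) * Em + 2 * e"
    and "E1 + (4 * E2 + 2 * q * E2\<^sup>2) + q * E1 * (4 * E2 + 2 * q * E2\<^sup>2) - Ep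
           \<le> 2 * (1 + q * E2) * (E1 + E2 + q * E1 * E2 - (4 * e + 2 * q * e\<^sup>2) + \<tau>)"
  shows "2 * (1 + q * e) * Eo + 2 * e - E1 - E2 \<le> 2 * (1 + q * E2) * \<tau>"
proof -
  have "2 * (1 + q * e) * (Eo + Em) \<le> 2 * (1 + q * e) * (2 * (1 + q * E2) * e + 2 * E2)"
    using assms(1-3) by (intro mult_left_mono) auto
  then show ?thesis using assms(4,5) by (simp add: algebra_simps power2_eq_square)
qed

text \<open>The median of the small triangle \<open>x\<close>, \<open>\<zeta>1 t\<close>, \<open>\<zeta>2 t\<close> is at least its Euclidean or hyperbolic
  value; being close to it needs a bound from above, which curvature bounded below yields because \<open>\<zeta>2 t\<close> is
  an interior point of a geodesic starting at \<open>x\<close>.\<close>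

lemma merge_error:
  fixes x :: "'a::metric_space"
  assumes q: "q \<ge> 0" and X: "CBB (- q) (UNIV :: 'a set)"
    and p1: "scaled_path q x w1 T \<zeta>1" and p2: "scaled_path q x w2 T \<zeta>2"
    and t: "0 < t" "3 * t \<le> T"
  defines "E2 \<equiv> md q (dist x (\<zeta>2 t))" and "l \<equiv> dist (\<zeta>1 t) (\<zeta>2 t)"
  assumes small: "q * E2 \<le> 1 / 2" and g: "geodesic \<gamma> (\<zeta>1 t) (\<zeta>2 t)"
  shows "2 * (1 + q * md q (l / 2)) * md q (dist x (\<gamma> (l / 2))) + 2 * md q (l / 2) - md q (dist x (\<zeta>1 t)) - E2
     \<le> 2 * (1 + q * E2) * (apex q x (\<zeta>1 (3 * t)) (\<zeta>2 (3 * t)) / 9 - apex q x (\<zeta>1 t) (\<zeta>2 t))"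
proof -
  \<comment> \<open>The factor is that of the duplication formula for \<open>sn\<close>, so
    \<open>z\<close> is exactly twice as far from \<open>x\<close> as \<open>\<zeta>2 t\<close>. The
    smallness of \<open>q * E2\<close> keeps \<open>r\<close> below \<open>3 * t\<close>, which is
    where the 3 comes from.\<close>
  define r where "r = 2 * (1 + q * E2) * t"
  define z where "z = \<zeta>2 r"
  define u where "u = dist x (\<zeta>2 t)"
  define m where "m = \<gamma> (l / 2)"
  define e where "e = md q (l / 2)"
  have E2: "E2 \<ge> 0" using q by (simp add: E2_def md_nonneg)
  have qE2: "q * E2 \<ge> 0" using q E2 by simp
  have "2 * (1 + q * E2) \<le> 3" "2 * (1 + q * E2) \<ge> 1" using small qE2 by auto
  then have r: "t \<le> r" "r \<le> 3 * t"
    unfolding r_def using t mult_right_mono[of _ 3 t] mult_right_mono[of 1 _ t] by auto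
  have tT: "t \<in> {0..T}" "r \<in> {0..T}" "3 * t \<in> {0..T}" using t r by auto
  have "sn q (dist x z) = w2 * r" using p2 tT unfolding scaled_path_def z_def by blast
  also have "\<dots> = 2 * (1 + q * E2) * (w2 * t)" by (simp add: r_def)
  also have "w2 * t = sn q u" using p2 tT unfolding scaled_path_def u_def by simp
  finally have "sn q (dist x z) = sn q (2 * u)" using q by (simp add: sn_double u_def E2_def)
  then have xz: "dist x z = 2 * u"
    using sn_strict_mono[OF q] by (metis linorder_neqE_linordered_idom less_irrefl)
  have E2z: "md q (dist x z) = 4 * E2 + 2 * q * E2\<^sup>2"
    unfolding xz by (simp add: md_double[OF q] E2_def u_def)
  have up: "2 * (1 + q * E2) * apex q x (\<zeta>2 t) v \<le> apex q x z v" for v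
  proof -
    have "r * apex q x (\<zeta>2 t) v \<le> t * apex q x z v"
      using p2 tT r(1) unfolding scaled_path_def z_def by blast
    then have "t * (2 * (1 + q * E2) * apex q x (\<zeta>2 t) v) \<le> t * apex q x z v"
      by (simp add: r_def algebra_simps)
    then show ?thesis using t by simp
  qed
  have xz': "dist x (\<zeta>2 t) = dist x z / 2" using xz by (simp add: u_def)
  have 1: "md q (dist x m) + md q (dist z m) \<le> 2 * (1 + q * E2) * md q (dist (\<zeta>2 t) m) + 2 * E2"
    using up[of m] apex_midpoint[OF q xz', of m] unfolding xz'[symmetric] E2_def[symmetric] by linarith
  have "dist m (\<zeta>2 t) = l - l / 2"
    unfolding m_def l_def by (rule geodesic_dist(2)[OF g]) auto
  then have "dist (\<zeta>2 t) m = l / 2" by (simp add: dist_commute)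
  then have mz: "md q (dist (\<zeta>2 t) m) = e" by (simp only: e_def)
  have 2: "md q (dist (\<zeta>1 t) z) + md q (dist (\<zeta>2 t) z) \<le> 2 * (1 + q * e) * md q (dist m z) + 2 * e"
    using CBB_midpoint[OF q X g, of z] by (simp add: e_def l_def m_def)
  have "u \<le> dist (\<zeta>2 t) z" using xz dist_triangle[of x z "\<zeta>2 t"] by (simp add: u_def)
  then have "E2 \<le> md q (dist (\<zeta>2 t) z)" unfolding E2_def u_def by (intro md_mono q) auto
  then have 2: "md q (dist (\<zeta>1 t) z) + E2 \<le> 2 * (1 + q * e) * md q (dist z m) + 2 * e"
    using 2 by (simp add: dist_commute)
  have L: "md q l = 4 * e + 2 * q * e\<^sup>2"
    using md_double[OF q, of "l / 2"] by (simp add: e_def)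
  \<comment> \<open>Monotonicity is applied to one argument at a time, from \<open>z\<close> to
    \<open>\<zeta>2 (3 * t)\<close> and from \<open>\<zeta>1 t\<close> to
    \<open>\<zeta>1 (3 * t)\<close>. The combined factor is \<open>r / (3 * t)\<close> times 1/3,
    that is \<open>2 * (1 + q * E2) / 9\<close>.\<close>
  have h1: "3 * t * apex q x z (\<zeta>1 t) \<le> r * apex q x (\<zeta>2 (3 * t)) (\<zeta>1 t)"
    using p2 tT r(2) unfolding scaled_path_def z_def by blast
  have h2: "3 * t * apex q x (\<zeta>1 t) (\<zeta>2 (3 * t)) \<le> t * apex q x (\<zeta>1 (3 * t)) (\<zeta>2 (3 * t))"
  proof -
    have "t \<le> 3 * t" using t by simp
    then show ?thesis using p1 tT unfolding scaled_path_def by blast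
  qed
  have cancel: "a \<le> b" if "t * a \<le> t * b" for a b
    using that t(1) by (rule mult_left_le_imp_le)
  have "t * (3 * apex q x (\<zeta>1 t) (\<zeta>2 (3 * t))) \<le> t * apex q x (\<zeta>1 (3 * t)) (\<zeta>2 (3 * t))"
    using h2 by (simp only: mult.assoc mult.left_commute)
  then have "3 * apex q x (\<zeta>1 t) (\<zeta>2 (3 * t)) \<le> apex q x (\<zeta>1 (3 * t)) (\<zeta>2 (3 * t))"
    by (rule cancel)
  then have "2 * (1 + q * E2) * (3 * apex q x (\<zeta>1 t) (\<zeta>2 (3 * t))) \<le> 2 * (1 + q * E2) * apex q x (\<zeta>1 (3 * t)) (\<zeta>2 (3 * t))"
    using qE2 by (intro mult_left_mono) auto
  moreover have "t * (3 * apex q x z (\<zeta>1 t)) \<le> t * (2 * (1 + q * E2) * apex q x (\<zeta>1 t) (\<zeta>2 (3 * t)))"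
    using h1 by (simp only: r_def apex_commute[of q x "\<zeta>2 (3 * t)"] mult.assoc mult.left_commute)
  then have "3 * apex q x z (\<zeta>1 t) \<le> 2 * (1 + q * E2) * apex q x (\<zeta>1 t) (\<zeta>2 (3 * t))"
    by (rule cancel)
  ultimately have 3: "apex q x (\<zeta>1 t) z \<le> 2 * (1 + q * E2) * (apex q x (\<zeta>1 (3 * t)) (\<zeta>2 (3 * t)) / 9)"
    by (simp add: apex_commute[of q x z])
  show ?thesis
    unfolding m_def[symmetric] e_def[symmetric]
  proof (rule merge_error_algebra[OF q _ 1[unfolded mz] 2])
    show "e \<ge> 0" using q by (simp add: e_def md_nonneg)
    have "apex q x (\<zeta>1 t) (\<zeta>2 t) = md q (dist x (\<zeta>1 t)) + E2 + q * md q (dist x (\<zeta>1 t)) * E2 - (4 * e + 2 * q * e\<^sup>2)"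
      by (simp add: apex_def E2_def l_def[symmetric] L)
    moreover have "apex q x (\<zeta>1 t) z = md q (dist x (\<zeta>1 t)) + (4 * E2 + 2 * q * E2\<^sup>2)
        + q * md q (dist x (\<zeta>1 t)) * (4 * E2 + 2 * q * E2\<^sup>2) - md q (dist (\<zeta>1 t) z)"
      by (simp only: apex_def E2z)
    ultimately show "md q (dist x (\<zeta>1 t)) + (4 * E2 + 2 * q * E2\<^sup>2) + q * md q (dist x (\<zeta>1 t)) * (4 * E2 + 2 * q * E2\<^sup>2)
        - md q (dist (\<zeta>1 t) z)
      \<le> 2 * (1 + q * E2) * (md q (dist x (\<zeta>1 t)) + E2 + q * md q (dist x (\<zeta>1 t)) * E2 - (4 * e + 2 * q * e\<^sup>2)
        + (apex q x (\<zeta>1 (3 * t)) (\<zeta>2 (3 * t)) / 9 - apex q x (\<zeta>1 t) (\<zeta>2 t)))"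
      using 3 by simp
  qed
qed

subsection \<open>The Lang--Schroeder--Sturm inequality\<close>

text \<open>In hyperboloid coordinates the sum of two points is \<open>2 * (1 + q * e)\<close> times
  their midpoint, twice the cosh of half the rescaled distance, and the kernel at \<open>x\<close>
  is bilinear. The midpoint with this weight therefore replaces both points, and \<open>err\<close>
  is the defect of the median identity at \<open>x\<close>.\<close>

lemma apex_combine_cross:
  fixes q e :: real
  assumes "d1 + d2 \<le> 2 * (1 + q * e) * dm + 2 * e"
    and eq: "2 * (1 + q * e) * D + 2 * e = E1 + E2 + err"
  shows "2 * (1 + q * e) * (D + Ej + q * D * Ej - dm)
       \<le> (E1 + Ej + q * E1 * Ej - d1) + (E2 + Ej + q * E2 * Ej - d2) + err * (1 + q * Ej)"
proof -
  have MD: "2 * (1 + q * e) * D = E1 + E2 + err - 2 * e" using eq by simp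
  have "2 * (1 + q * e) * (D + Ej + q * D * Ej - dm)
     = (2 * (1 + q * e) * D) * (1 + q * Ej) + 2 * (1 + q * e) * Ej - 2 * (1 + q * e) * dm"
    by (simp add: algebra_simps)
  then show ?thesis using assms(1) unfolding MD by (simp add: algebra_simps)
qed

text \<open>Here \<open>4 * e + 2 * q * e\<^sup>2\<close> is \<open>md\<close> of the full distance
  between the two points, so the middle term is twice their kernel. Everything else carries the
  factor \<open>err\<close>.\<close>

lemma apex_combine_square:
  fixes q e :: real
  assumes eq: "2 * (1 + q * e) * D + 2 * e = E1 + E2 + err"
  shows "(2 * (1 + q * e))\<^sup>2 * (2 * D + q * D\<^sup>2)
       = (2 * E1 + q * E1\<^sup>2) + 2 * (E1 + E2 + q * E1 * E2 - (4 * e + 2 * q * e\<^sup>2)) + (2 * E2 + q * E2\<^sup>2)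
         + err * (2 * (2 * (1 + q * e)) + 2 * q * (E1 + E2 - 2 * e) + q * err)"
proof -
  have MD: "2 * (1 + q * e) * D = E1 + E2 + err - 2 * e" using eq by simp
  have "(2 * (1 + q * e))\<^sup>2 * (2 * D + q * D\<^sup>2)
     = 2 * (2 * (1 + q * e)) * (2 * (1 + q * e) * D) + q * (2 * (1 + q * e) * D)\<^sup>2"
    by (simp add: algebra_simps power2_eq_square)
  then show ?thesis unfolding MD by (simp add: algebra_simps power2_eq_square)
qed

text \<open>In the model plane the kernel is a Gram matrix of vectors at \<open>x\<close>. In
  \<open>X\<close>, merging two points reduces their number at the price of an error, and passing to
  the limit of small scales before concluding removes the error, so the induction loses
  nothing.\<close>

theorem CBB_apex_nonneg:
  fixes x :: "'a::metric_space" and p :: "'i \<Rightarrow> 'a"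
  assumes q: "q \<ge> 0" and X: "CBB (- q) (UNIV :: 'a set)"
    and "finite I" "\<And>i. i \<in> I \<Longrightarrow> c i \<ge> 0"
  shows "0 \<le> (\<Sum>i\<in>I. \<Sum>j\<in>I. c i * c j * apex q x (p i) (p j))"
  using assms(3,4)
proof (induction "card I" arbitrary: I c p rule: less_induct)
  case less
  note fin = less.prems(1) and c = less.prems(2)
  have diag: "apex q x v v = 2 * md q (dist x v) + q * (md q (dist x v))\<^sup>2" for v
    by (simp add: apex_def power2_eq_square)
  have diag_nonneg: "apex q x v v \<ge> 0" for v
    unfolding diag using q by (simp add: md_nonneg)
  show ?case
  proof (cases "\<exists>i1\<in>I. \<exists>i2\<in>I. i1 \<noteq> i2")
    case False
    then have "I = {} \<or> (\<exists>i. I = {i})" by blast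
    then show ?thesis using diag_nonneg by (auto simp: zero_le_mult_iff)
  next
    case True
    then obtain i1 i2 where i: "i1 \<in> I" "i2 \<in> I" "i1 \<noteq> i2" by blast
    define J where "J = I - {i1, i2}"
    have J: "finite J" "i1 \<notin> J" "i2 \<notin> J" "I = insert i1 (insert i2 J)"
      using fin i by (auto simp: J_def)
    define w where "w j = c j * sn q (dist x (p j))" for j
    \<comment> \<open>The summands of the denominator yield in turn \<open>T \<le> 1\<close>,
      \<open>c j * T \<le> 1\<close> for the existence of the paths, and
      \<open>q * (w i2)\<^sup>2 * T \<le> 1\<close> for the smallness condition of
      \<open>merge_error\<close>.\<close>
    define T where "T = 1 / (1 + sum c I + q * (w i2)\<^sup>2)"
    have csum: "c j \<le> sum c I" if "j \<in> I" for j
      using that fin c by (intro member_le_sum) auto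
    have csum0: "sum c I \<ge> 0" using c by (rule sum_nonneg)
    have qw: "q * (w i2)\<^sup>2 \<ge> 0" using q by simp
    have T: "T > 0" using csum0 qw by (simp add: T_def)
    have cT: "c j * T \<le> 1" if "j \<in> I" for j
      using csum[OF that] csum0 qw by (simp add: T_def)
    have T1: "T \<le> 1" "q * (w i2)\<^sup>2 * T \<le> 1" using csum0 qw by (simp_all add: T_def)
    have "\<forall>j\<in>I. \<exists>\<zeta>. scaled_path q x (w j) T \<zeta> \<and> (\<forall>t\<in>{0..T}. \<forall>z. apex q x (\<zeta> t) z \<le> c j * t * apex q x (p j) z)"
    proof
      fix j assume "j \<in> I"
      from scaled_path_exists[OF q X c[OF this] cT[OF this], of x "p j"]
      show "\<exists>\<zeta>. scaled_path q x (w j) T \<zeta> \<and> (\<forall>t\<in>{0..T}. \<forall>z. apex q x (\<zeta> t) z \<le> c j * t * apex q x (p j) z)"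
        unfolding w_def by metis
    qed
    then obtain \<zeta> where path: "\<And>j. j \<in> I \<Longrightarrow> scaled_path q x (w j) T (\<zeta> j)"
      and toward: "\<And>j t z. j \<in> I \<Longrightarrow> t \<in> {0..T} \<Longrightarrow> apex q x (\<zeta> j t) z \<le> c j * t * apex q x (p j) z"
      by metis
    \<comment> \<open>By the choice of paths, \<open>h t\<close> is \<open>w i1 * w i2\<close> times
      the cosine of the comparison angle at \<open>x\<close>.\<close>
    define h where "h t = apex q x (\<zeta> i1 t) (\<zeta> i2 t) / t\<^sup>2" for t
    define Q where "Q = (\<Sum>i\<in>I. \<Sum>j\<in>I. c i * c j * apex q x (p i) (p j))"
    define R where "R = (\<Sum>i\<in>I. dist x (p i))"
    define B where "B = md q (2 * R)"
    have B: "B \<ge> 0" using q by (simp add: B_def md_nonneg)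
    have qB: "q * B \<ge> 0" using q B by simp
    have R0: "R \<ge> 0" by (simp add: R_def sum_nonneg)
    \<comment> \<open>A bound, uniform in \<open>t\<close>, for the total factor of
      \<open>err\<close>: the cross terms with the remaining points, then the three terms from the
      square of the merged point.\<close>
    define K where "K = 2 * (real (card J) * (1 + q * B)) + 2 * (2 * (1 + q * B)) + 2 * q * (B + B) + q * (2 * (1 + q * B) * B + 2 * B)"
    have K: "K \<ge> 0" unfolding K_def using q B qB by simp
    have step: "- (3 * K * (h (3 * t) - h t)) \<le> Q" if t: "0 < t" "3 * t \<le> T" for t
    proof -
      have tT: "t \<in> {0..T}" using t by auto
      define z where "z j = \<zeta> j t" for j
      define E where "E j = md q (dist x (z j))" for j
      have snz: "sn q (dist x (z j)) = w j * t" if "j \<in> I" for j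
        using path[OF that] tT unfolding scaled_path_def z_def by blast
      have dzp: "dist x (z j) \<le> dist x (p j)" if j: "j \<in> I" for j
      proof (rule ccontr)
        assume "\<not> ?thesis"
        then have "sn q (dist x (p j)) < sn q (dist x (z j))" by (intro sn_strict_mono q) auto
        also have "\<dots> = (c j * t) * sn q (dist x (p j))" by (simp add: snz[OF j] w_def)
        also have "\<dots> \<le> 1 * sn q (dist x (p j))"
        proof (rule mult_right_mono)
          have "c j * t \<le> c j * T" using tT c[OF j] by (intro mult_left_mono) auto
          then show "c j * t \<le> 1" using cT[OF j] by simp
        qed (use q in \<open>simp add: sn_nonneg\<close>)
        finally show False by simp
      qed
      have dzR: "dist x (z j) \<le> R" if j: "j \<in> I" for j
      proof -
        have "dist x (p j) \<le> R" unfolding R_def using j fin by (intro member_le_sum) auto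
        then show ?thesis using dzp[OF j] by simp
      qed
      have mdB: "md q d \<le> B" if "0 \<le> d" "d \<le> 2 * R" for d
        unfolding B_def using that q by (intro md_mono) auto
      have E: "0 \<le> E j" for j using q by (simp add: E_def md_nonneg)
      have EB: "E j \<le> B" if "j \<in> I" for j
        unfolding E_def using dzR[OF that] R0 by (intro mdB) auto
      define l where "l = dist (z i1) (z i2)"
      obtain \<gamma> where g: "geodesic \<gamma> (z i1) (z i2)" using CBB_geodesic[OF X] by blast
      define m where "m = \<gamma> (l / 2)"
      define e where "e = md q (l / 2)"
      define M where "M = 2 * (1 + q * e)"
      define D where "D = md q (dist x m)"
      define err where "err = M * D + 2 * e - E i1 - E i2"
      have e: "e \<ge> 0" using q by (simp add: e_def md_nonneg)
      have l: "l \<ge> 0" "l \<le> 2 * R"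
        using dzR[OF i(1)] dzR[OF i(2)] dist_triangle3[of "z i1" "z i2" x] by (auto simp: l_def)
      have eB: "e \<le> B" unfolding e_def using l R0 by (intro mdB) auto
      have "dist (z i1) m = l / 2" unfolding m_def l_def by (rule geodesic_dist(1)[OF g]) auto
      then have "dist x m \<le> 2 * R"
        using dist_triangle[of x m "z i1"] dzR[OF i(1)] l by simp
      then have DB: "D \<le> B" unfolding D_def by (intro mdB) auto
      have D: "D \<ge> 0" using q by (simp add: D_def md_nonneg)
      have midp: "md q (dist (z i1) v) + md q (dist (z i2) v) \<le> 2 * (1 + q * e) * md q (dist m v) + 2 * e" for v
        using CBB_midpoint[OF q X g, of v] by (simp add: m_def e_def l_def)
      have err0: "err \<ge> 0"
        using midp[of x] by (simp add: err_def M_def E_def D_def dist_commute)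
      have MB: "M \<le> 2 * (1 + q * B)" unfolding M_def using eB q by (simp add: mult_left_mono)
      have M0: "M \<ge> 0" unfolding M_def using q e by simp
      have errB: "err \<le> 2 * (1 + q * B) * B + 2 * B"
      proof -
        have "M * D \<le> 2 * (1 + q * B) * B" using MB DB D M0 qB by (intro mult_mono) auto
        then show ?thesis unfolding err_def using eB E[of i1] E[of i2] by linarith
      qed
      have qE2: "q * E i2 \<le> 1 / 2"
      proof -
        have "2 * E i2 \<le> (sn q (dist x (z i2)))\<^sup>2"
          unfolding sn_square[OF q] E_def using q by simp
        also have "\<dots> = (w i2)\<^sup>2 * t\<^sup>2" by (simp add: snz[OF i(2)] power_mult_distrib)
        finally have "q * (2 * E i2) \<le> q * ((w i2)\<^sup>2 * t\<^sup>2)" using q by (rule mult_left_mono)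
        also have "\<dots> = (q * (w i2)\<^sup>2) * (t * t)" by (simp add: power2_eq_square)
        also have "\<dots> \<le> (q * (w i2)\<^sup>2) * (T * 1)"
          using t T T1 qw by (intro mult_left_mono mult_mono) auto
        finally show ?thesis using T1 by simp
      qed
      define \<tau> where "\<tau> = apex q x (\<zeta> i1 (3 * t)) (\<zeta> i2 (3 * t)) / 9 - apex q x (z i1) (z i2)"
      have \<tau>: "\<tau> = t\<^sup>2 * (h (3 * t) - h t)"
        using t by (simp add: \<tau>_def h_def z_def field_simps power2_eq_square)
      have err_le: "err \<le> 2 * (1 + q * E i2) * \<tau>"
        using merge_error[OF q X path[OF i(1)] path[OF i(2)] t, of \<gamma>] qE2 g
        by (simp add: err_def M_def e_def l_def D_def m_def E_def z_def \<tau>_def)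
      have qE0: "q * E i2 \<ge> 0" using q E by simp
      have "2 * (1 + q * E i2) > 0" using qE0 by simp
      \<comment> \<open>The median bound at \<open>x\<close> makes \<open>err\<close> nonnegative,
        and this forces the sign of \<open>\<tau>\<close>; hence the factor depending on
        \<open>E i2\<close> may be enlarged to 3.\<close>
      then have \<tau>0: "\<tau> \<ge> 0" using err_le err0 by (smt (verit) mult_pos_neg)
      have err_le: "err \<le> 3 * \<tau>"
      proof -
        have "2 * (1 + q * E i2) * \<tau> \<le> 3 * \<tau>" using qE2 \<tau>0 by (intro mult_right_mono) auto
        then show ?thesis using err_le by simp
      qed
      define A where "A j k = apex q x (z j) (z k)" for j k
      have Asym: "A j k = A k j" for j k by (simp add: A_def apex_commute)
      \<comment> \<open>Index \<open>i1\<close> takes over the midpoint with weight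
        \<open>M\<close>, and \<open>i2\<close> is dropped. All other weights are one, having been
        absorbed in the speeds.\<close>
      define p' where "p' = z(i1 := m)"
      define c' where "c' = (\<lambda>_. 1)(i1 := M)"
      define I' where "I' = insert i1 J"
      have "card I' < card I" using J i by (simp add: I'_def)
      then have "0 \<le> (\<Sum>i\<in>I'. \<Sum>j\<in>I'. c' i * c' j * apex q x (p' i) (p' j))"
        using J(1) M0 by (intro less.hyps) (auto simp: I'_def c'_def)
      also have "\<dots> = M\<^sup>2 * apex q x m m + 2 * (\<Sum>j\<in>J. M * apex q x m (z j)) + (\<Sum>j\<in>J. \<Sum>k\<in>J. A j k)"
      proof -
        have p'J: "p' j = z j" "c' j = 1" if "j \<in> J" for j using that J by (auto simp: p'_def c'_def)
        have 1: "(\<Sum>j\<in>I'. c' i1 * c' j * apex q x (p' i1) (p' j)) = M\<^sup>2 * apex q x m m + (\<Sum>j\<in>J. M * apex q x m (z j))"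
          unfolding I'_def using J p'J by (simp add: p'_def c'_def power2_eq_square cong: sum.cong)
        have 2: "(\<Sum>j\<in>I'. c' i * c' j * apex q x (p' i) (p' j)) = M * apex q x m (z i) + (\<Sum>j\<in>J. A i j)" if "i \<in> J" for i
        proof -
          have "i \<noteq> i1" using that J by auto
          then have "c' i = 1" "p' i = z i" "c' i1 = M" "p' i1 = m" by (auto simp: c'_def p'_def)
          then show ?thesis unfolding I'_def using J p'J by (simp add: A_def apex_commute[of q x "z i" m])
        qed
        have "(\<Sum>i\<in>I'. \<Sum>j\<in>I'. c' i * c' j * apex q x (p' i) (p' j))
           = (\<Sum>j\<in>I'. c' i1 * c' j * apex q x (p' i1) (p' j)) + (\<Sum>i\<in>J. \<Sum>j\<in>I'. c' i * c' j * apex q x (p' i) (p' j))"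
          using J(1,2) by (subst (1) I'_def) simp
        then show ?thesis unfolding 1 using 2 by (simp add: sum.distrib)
      qed
      also have "\<dots> \<le> (A i1 i1 + 2 * A i1 i2 + A i2 i2 + err * (2 * M + 2 * q * (E i1 + E i2 - 2 * e) + q * err))
           + 2 * (\<Sum>j\<in>J. A i1 j + A i2 j + err * (1 + q * E j)) + (\<Sum>j\<in>J. \<Sum>k\<in>J. A j k)"
      proof -
        have eq: "2 * (1 + q * e) * D + 2 * e = E i1 + E i2 + err" by (simp add: err_def M_def)
        have L: "md q l = 4 * e + 2 * q * e\<^sup>2" using md_double[OF q, of "l / 2"] by (simp add: e_def)
        have "M\<^sup>2 * apex q x m m = A i1 i1 + 2 * A i1 i2 + A i2 i2 + err * (2 * M + 2 * q * (E i1 + E i2 - 2 * e) + q * err)"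
          using apex_combine_square[OF eq] unfolding A_def diag
          unfolding M_def apex_def D_def[symmetric] E_def[symmetric] l_def[symmetric] L by simp
        moreover have "M * apex q x m (z j) \<le> A i1 j + A i2 j + err * (1 + q * E j)" for j
          using apex_combine_cross[OF midp[of "z j"] eq, where Ej = "E j"]
          unfolding A_def M_def apex_def D_def[symmetric] E_def[symmetric] by simp
        ultimately show ?thesis by (intro add_mono mult_left_mono sum_mono) auto
      qed
      also have "\<dots> = (\<Sum>j\<in>I. \<Sum>k\<in>I. A j k) + err * (2 * (\<Sum>j\<in>J. 1 + q * E j) + 2 * M + 2 * q * (E i1 + E i2 - 2 * e) + q * err)"
      proof -
        have "(\<Sum>j\<in>J. A j i1) = (\<Sum>j\<in>J. A i1 j)" "(\<Sum>j\<in>J. A j i2) = (\<Sum>j\<in>J. A i2 j)" "A i2 i1 = A i1 i2"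
          by (simp_all add: Asym)
        then have "(\<Sum>j\<in>I. \<Sum>k\<in>I. A j k) = A i1 i1 + 2 * A i1 i2 + A i2 i2 + 2 * (\<Sum>j\<in>J. A i1 j + A i2 j) + (\<Sum>j\<in>J. \<Sum>k\<in>J. A j k)"
          unfolding J(4) using J(1-3) i(3) by (simp add: sum.distrib)
        then show ?thesis by (simp add: sum.distrib sum_distrib_left algebra_simps)
      qed
      also have "\<dots> \<le> (\<Sum>j\<in>I. \<Sum>k\<in>I. A j k) + err * K"
      proof -
        have "(\<Sum>j\<in>J. 1 + q * E j) \<le> (\<Sum>j\<in>J. 1 + q * B)"
          using EB J(4) q by (intro sum_mono) (auto intro!: mult_left_mono)
        then have "(\<Sum>j\<in>J. 1 + q * E j) \<le> real (card J) * (1 + q * B)" by simp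
        moreover have "2 * q * (E i1 + E i2 - 2 * e) \<le> 2 * q * (B + B)"
          using EB[OF i(1)] EB[OF i(2)] e q by (intro mult_left_mono) auto
        moreover have "q * err \<le> q * (2 * (1 + q * B) * B + 2 * B)" using errB q by (rule mult_left_mono)
        ultimately have "2 * (\<Sum>j\<in>J. 1 + q * E j) + 2 * M + 2 * q * (E i1 + E i2 - 2 * e) + q * err \<le> K"
          unfolding K_def using MB by linarith
        then show ?thesis using err0 by (simp add: mult_left_mono)
      qed
      also have "(\<Sum>j\<in>I. \<Sum>k\<in>I. A j k) \<le> t\<^sup>2 * Q"
      proof -
        have "A j k \<le> t\<^sup>2 * (c j * c k * apex q x (p j) (p k))" if "j \<in> I" "k \<in> I" for j k
        proof -
          have "A j k \<le> c j * t * apex q x (p j) (z k)"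
            unfolding A_def z_def by (rule toward[OF that(1) tT])
          also have "\<dots> = c j * t * apex q x (z k) (p j)" by (simp add: apex_commute)
          also have "\<dots> \<le> c j * t * (c k * t * apex q x (p k) (p j))"
            unfolding z_def using c[OF that(1)] t by (intro mult_left_mono toward[OF that(2) tT]) auto
          also have "\<dots> = t\<^sup>2 * (c j * c k * apex q x (p j) (p k))"
            by (simp add: power2_eq_square apex_commute)
          finally show ?thesis .
        qed
        then show ?thesis unfolding Q_def sum_distrib_left by (intro sum_mono) auto
      qed
      also have "err * K \<le> 3 * \<tau> * K" using err_le K by (rule mult_right_mono)
      finally have "0 \<le> t\<^sup>2 * (Q + 3 * K * (h (3 * t) - h t))"
        by (simp add: \<tau> algebra_simps)
      then show ?thesis using t by (simp add: zero_le_mult_iff)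
    qed
    \<comment> \<open>Scales decrease by the factor 3 because the error compares \<open>t\<close>
      with \<open>3 * t\<close>; it becomes a difference of consecutive terms of a convergent
      sequence.\<close>
    define a where "a n = h (T / 3 ^ n)" for n :: nat
    have tn: "T / 3 ^ n \<in> {0..T}" "T / 3 ^ n > 0" for n :: nat
      using T by (auto simp: divide_le_eq mult_le_cancel_left1)
    have dec: "a (Suc n) \<le> a n" for n
    proof -
      let ?t = "T / 3 ^ Suc n" and ?s = "T / 3 ^ n"
      have s: "?s = 3 * ?t" by simp
      have le: "?t \<le> ?s" using tn(2)[of "Suc n"] unfolding s by simp
      have "?s * apex q x (\<zeta> i1 ?t) (\<zeta> i2 ?t) \<le> ?t * apex q x (\<zeta> i1 ?s) (\<zeta> i2 ?t)"
        using path[OF i(1)] tn(1) le unfolding scaled_path_def by blast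
      then have "3 * apex q x (\<zeta> i1 ?t) (\<zeta> i2 ?t) \<le> apex q x (\<zeta> i1 ?s) (\<zeta> i2 ?t)"
        using tn(2)[of "Suc n"] unfolding s by (simp only: mult.left_commute[of 3] mult.assoc mult_le_cancel_left_pos)
      moreover have "?s * apex q x (\<zeta> i2 ?t) (\<zeta> i1 ?s) \<le> ?t * apex q x (\<zeta> i2 ?s) (\<zeta> i1 ?s)"
        using path[OF i(2)] tn(1) le unfolding scaled_path_def by blast
      then have "3 * apex q x (\<zeta> i2 ?t) (\<zeta> i1 ?s) \<le> apex q x (\<zeta> i2 ?s) (\<zeta> i1 ?s)"
        using tn(2)[of "Suc n"] unfolding s by (simp only: mult.left_commute[of 3] mult.assoc mult_le_cancel_left_pos)
      ultimately have "9 * apex q x (\<zeta> i1 ?t) (\<zeta> i2 ?t) \<le> apex q x (\<zeta> i1 ?s) (\<zeta> i2 ?s)"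
        by (simp add: apex_commute[of q x _ "\<zeta> i1 ?s"])
      then have "9 * apex q x (\<zeta> i1 ?t) (\<zeta> i2 ?t) / ?s\<^sup>2 \<le> apex q x (\<zeta> i1 ?s) (\<zeta> i2 ?s) / ?s\<^sup>2"
        by (rule divide_right_mono) simp
      moreover have "9 * apex q x (\<zeta> i1 ?t) (\<zeta> i2 ?t) / ?s\<^sup>2 = h ?t"
        unfolding s h_def power_mult_distrib by simp
      ultimately show ?thesis by (simp add: a_def h_def)
    qed
    have low: "- (w i1 * w i2) \<le> a n" for n
    proof -
      let ?t = "T / 3 ^ n"
      have "sn q (dist x (\<zeta> i1 ?t)) = w i1 * ?t" "sn q (dist x (\<zeta> i2 ?t)) = w i2 * ?t"
        using path[OF i(1)] path[OF i(2)] tn(1) unfolding scaled_path_def by blast+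
      then have "- (w i1 * ?t * (w i2 * ?t)) \<le> apex q x (\<zeta> i1 ?t) (\<zeta> i2 ?t)"
        using apex_ge[OF q, of x "\<zeta> i1 ?t" "\<zeta> i2 ?t"] by metis
      then have "- (w i1 * ?t * (w i2 * ?t)) / ?t\<^sup>2 \<le> a n"
        unfolding a_def h_def by (rule divide_right_mono) simp
      moreover have "- (w i1 * s * (w i2 * s)) / s\<^sup>2 = - (w i1 * w i2)" if "s > 0" for s
        using that by (simp add: power2_eq_square)
      ultimately show ?thesis using tn(2)[of n] by metis
    qed
    have "decseq a" using dec by (rule decseq_SucI)
    moreover have "bdd_below (range a)" using low by (intro bdd_belowI2)
    ultimately obtain L where L: "a \<longlonglongrightarrow> L"
      using decseq_convergent[of a] low by metis
    have "(\<lambda>n. - (3 * K * (a n - a (Suc n)))) \<longlonglongrightarrow> - (3 * K * (L - L))"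
      by (intro tendsto_intros L LIMSEQ_Suc)
    moreover have "- (3 * K * (a n - a (Suc n))) \<le> Q" for n
      using step[of "T / 3 ^ Suc n"] tn[of n] T by (simp add: a_def)
    ultimately have "- (3 * K * (L - L)) \<le> Q" using LIMSEQ_le_const2 by blast
    then show ?thesis by (simp add: Q_def)
  qed
qed

subsection \<open>Strong convexity in CAT spaces\<close>

text \<open>Products become sums of cosh at sums and differences of the arguments. Their squares
  form two pairs of equal sum, the right one more spread out and hence with larger power sums, and
  cosh is a power series in the square with nonnegative coefficients.\<close>

lemma cosh_mult_cosh_le:
  fixes u v d w :: real
  assumes sq: "u\<^sup>2 + v\<^sup>2 = d\<^sup>2 + w\<^sup>2" and uv: "0 \<le> u * v" "u * v \<le> d * w"
  shows "cosh u * cosh v \<le> cosh d * cosh w"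
proof -
  define P where "P = (d + w)\<^sup>2"
  define P' where "P' = (u + v)\<^sup>2"
  define M where "M = (d - w)\<^sup>2"
  define M' where "M' = (u - v)\<^sup>2"
  have PM: "P - P' = M' - M" "P - P' \<ge> 0" "P' \<ge> M'"
    using sq uv by (simp_all add: P_def P'_def M_def M'_def power2_eq_square algebra_simps)
  have nn: "M \<ge> 0" "M' \<ge> 0" by (simp_all add: M_def M'_def)
  have pow: "P' ^ n + M' ^ n \<le> P ^ n + M ^ n" for n
  proof (cases n)
    case (Suc k)
    have "M' ^ n - M ^ n = (M' - M) * (\<Sum>i<Suc k. M' ^ i * M ^ (k - i))"
      unfolding Suc by (subst diff_power_eq_sum) (simp add: mult.commute)
    also have "\<dots> \<le> (P - P') * (\<Sum>i<Suc k. P ^ i * P' ^ (k - i))"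
      unfolding PM(1)[symmetric] using PM nn
      by (intro mult_left_mono sum_mono mult_mono power_mono) auto
    also have "\<dots> = P ^ n - P' ^ n"
      unfolding Suc by (subst diff_power_eq_sum) (simp add: mult.commute)
    finally show ?thesis by simp
  qed simp
  have series: "(if even n then a ^ n /\<^sub>R fact n else 0) + (if even n then b ^ n /\<^sub>R fact n else 0)
      = (if even n then ((a\<^sup>2) ^ (n div 2) + (b\<^sup>2) ^ (n div 2)) /\<^sub>R fact n else 0)" for a b :: real and n
    by (auto simp: power_mult[symmetric] distrib_left)
  have "cosh (u + v) + cosh (u - v) \<le> cosh (d + w) + cosh (d - w)"
  proof (rule sums_le)
    show "(\<lambda>n. if even n then (P' ^ (n div 2) + M' ^ (n div 2)) /\<^sub>R fact n else 0) sums (cosh (u + v) + cosh (u - v))"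
      using sums_add[OF cosh_converges[of "u + v"] cosh_converges[of "u - v"]]
      unfolding series P'_def M'_def .
    show "(\<lambda>n. if even n then (P ^ (n div 2) + M ^ (n div 2)) /\<^sub>R fact n else 0) sums (cosh (d + w) + cosh (d - w))"
      using sums_add[OF cosh_converges[of "d + w"] cosh_converges[of "d - w"]]
      unfolding series P_def M_def .
    show "(if even n then (P' ^ (n div 2) + M' ^ (n div 2)) /\<^sub>R fact n else 0)
       \<le> (if even n then (P ^ (n div 2) + M ^ (n div 2)) /\<^sub>R fact n else 0)" for n
      using pow by (auto intro!: scaleR_left_mono)
  qed
  then show ?thesis by (simp add: cosh_add cosh_diff)
qed

text \<open>Curvature at most -q implies curvature at most 0. The Euclidean median inequality is
  what projections and hulls need, independently of \<open>q\<close>.\<close>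

lemma CAT_midpoint_square:
  fixes x y p :: "'a::metric_space"
  assumes q: "q \<ge> 0" and X: "CAT (- q) (UNIV :: 'a set)" and g: "geodesic \<gamma> x y"
  shows "(dist (\<gamma> (dist x y / 2)) p)\<^sup>2 \<le> ((dist x p)\<^sup>2 + (dist y p)\<^sup>2) / 2 - (dist x y)\<^sup>2 / 4"
proof -
  define A B l d where "A = dist x p" and "B = dist y p" and "l = dist x y" and "d = dist (\<gamma> (l / 2)) p"
  note defs = A_def B_def l_def d_def
  define e where "e = md q (l / 2)"
  have mid: "2 * (1 + q * e) * md q d + 2 * e \<le> md q A + md q B"
    using CAT_midpoint[OF q X g, of p] by (simp add: defs e_def)
  have tri: "\<bar>A - B\<bar> \<le> l" "l \<le> A + B"
    unfolding A_def B_def l_def by metric+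
  have nn: "A \<ge> 0" "B \<ge> 0" "l \<ge> 0" "d \<ge> 0" by (simp_all add: defs)
  have "d\<^sup>2 \<le> (A\<^sup>2 + B\<^sup>2) / 2 - l\<^sup>2 / 4"
  proof (cases "q = 0")
    case True
    then show ?thesis using mid by (simp add: md_def e_def power_divide add_divide_distrib)
  next
    case False
    then have q': "q > 0" using q by simp
    define k where "k = sqrt q"
    have k: "k > 0" using q' by (simp add: k_def)
    \<comment> \<open>By addition formulas the hyperbolic median bound reads
      \<open>cosh w * cosh (k * d) \<le> cosh u * cosh v\<close>. The number \<open>r\<close>
      belonging to the Euclidean bound \<open>D\<close> satisfies
      \<open>r\<^sup>2 + w\<^sup>2 = u\<^sup>2 + v\<^sup>2\<close>, and
      \<open>v \<le> w \<le> u\<close> gives \<open>u * v \<le> r * w\<close>.\<close>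
    define u v w where "u = k * (A + B) / 2" and "v = k * \<bar>A - B\<bar> / 2" and "w = k * l / 2"
    define D where "D = (A\<^sup>2 + B\<^sup>2) / 2 - l\<^sup>2 / 4"
    have vw: "0 \<le> v" "v \<le> w" "w \<le> u"
      using tri k by (auto simp: u_def v_def w_def intro!: divide_right_mono mult_left_mono)
    have uvD: "u\<^sup>2 + v\<^sup>2 - w\<^sup>2 = k\<^sup>2 * D"
      by (simp add: u_def v_def w_def D_def power_divide power_mult_distrib) (simp add: power2_eq_square field_simps)
    have "w\<^sup>2 \<le> u\<^sup>2" "v\<^sup>2 \<le> w\<^sup>2" using vw by (auto intro!: power_mono)
    then have prod: "0 \<le> (u\<^sup>2 - w\<^sup>2) * (w\<^sup>2 - v\<^sup>2)" by simp
    have "0 \<le> k\<^sup>2 * D"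
      unfolding uvD[symmetric] using \<open>w\<^sup>2 \<le> u\<^sup>2\<close> zero_le_power2[of v] by linarith
    then have D: "D \<ge> 0" using k by (simp add: zero_le_mult_iff)
    define r where "r = k * sqrt D"
    have r2: "r\<^sup>2 = u\<^sup>2 + v\<^sup>2 - w\<^sup>2" using D by (simp add: r_def power_mult_distrib uvD)
    have r0: "r \<ge> 0" using k D by (simp add: r_def)
    have "(u * v)\<^sup>2 \<le> (r * w)\<^sup>2"
      using prod unfolding power_mult_distrib r2 by (simp add: algebra_simps power2_eq_square)
    then have "u * v \<le> r * w" by (rule power2_le_imp_le) (use r0 vw in auto)
    then have "cosh u * cosh v \<le> cosh r * cosh w"
      using vw r2 by (intro cosh_mult_cosh_le) auto
    moreover have "cosh w * cosh (k * d) \<le> cosh u * cosh v"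
    proof -
      have "2 * (1 + q * e) * (1 + q * md q d) = q * (2 * (1 + q * e) * md q d + 2 * e) + 2"
        by (simp add: algebra_simps)
      also have "\<dots> \<le> q * (md q A + md q B) + 2" using mid q by (simp add: mult_left_mono)
      also have "\<dots> = (1 + q * md q A) + (1 + q * md q B)" by (simp add: algebra_simps)
      also have "\<dots> = cosh (k * A) + cosh (k * B)" by (simp only: one_plus_md k_def)
      also have "\<dots> = cosh (u + k * (A - B) / 2) + cosh (u - k * (A - B) / 2)"
        by (simp add: u_def field_simps)
      also have "\<dots> = 2 * (cosh u * cosh (k * (A - B) / 2))" by (simp add: cosh_add cosh_diff)
      also have "cosh (k * (A - B) / 2) = cosh \<bar>k * (A - B) / 2\<bar>" by (simp only: cosh_real_abs)
      also have "\<bar>k * (A - B) / 2\<bar> = v" using k by (simp add: v_def abs_mult)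
      finally show ?thesis unfolding e_def one_plus_md k_def[symmetric] by (simp add: w_def)
    qed
    ultimately have "cosh w * cosh (k * d) \<le> cosh w * cosh r"
      by (subst mult.commute[of "cosh w" "cosh r"]) (rule order_trans)
    then have "cosh (k * d) \<le> cosh r" by (rule mult_left_le_imp_le) (simp add: cosh_real_pos)
    then have "k * d \<le> r" using k nn r0 by (subst (asm) cosh_real_nonneg_le_iff) auto
    then have "d \<le> sqrt D" using k by (simp add: r_def)
    then have "d\<^sup>2 \<le> (sqrt D)\<^sup>2" using nn by (intro power_mono)
    then show ?thesis using D by (simp add: D_def)
  qed
  then show ?thesis by (simp add: defs)
qed

section \<open>Strongly convex functions: minimizers and minimax\<close>

definition geo_convex :: "'a::metric_space set \<Rightarrow> bool" where
  "geo_convex C \<longleftrightarrow> (\<forall>x\<in>C. \<forall>y\<in>C. \<forall>\<gamma>. geodesic \<gamma> x y \<longrightarrow> \<gamma> ` {0..dist x y} \<subseteq> C)"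

lemma geo_convexD:
  "geo_convex C \<Longrightarrow> x \<in> C \<Longrightarrow> y \<in> C \<Longrightarrow> geodesic \<gamma> x y \<Longrightarrow> 0 \<le> s \<Longrightarrow> s \<le> dist x y \<Longrightarrow> \<gamma> s \<in> C"
  unfolding geo_convex_def by fastforce

text \<open>Two near minimizers far apart would have a point between them with value below the
  infimum, so minimizing sequences are Cauchy. Applying the midpoint condition to \<open>b\<close>
  and \<open>y\<close> turns \<open>\<beta>\<close> into \<open>2 * \<beta>\<close>.\<close>

lemma strongly_convex_minimizer:
  fixes C :: "'a::complete_space set"
  assumes C: "closed C" "C \<noteq> {}" and cont: "continuous_on C \<Phi>" and bdd: "bdd_below (\<Phi> ` C)"
    and \<beta>: "\<beta> > 0"
    and mid: "\<And>y z. y \<in> C \<Longrightarrow> z \<in> C \<Longrightarrow> \<exists>m\<in>C. \<Phi> m \<le> (\<Phi> y + \<Phi> z) / 2 - \<beta> * (dist y z)\<^sup>2"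
  obtains b where "b \<in> C" "\<And>y. y \<in> C \<Longrightarrow> \<Phi> b + 2 * \<beta> * (dist b y)\<^sup>2 \<le> \<Phi> y"
proof -
  define V where "V = Inf (\<Phi> ` C)"
  define \<epsilon> where "\<epsilon> n = inverse (real (Suc n))" for n
  have \<epsilon>: "\<epsilon> n > 0" for n by (simp add: \<epsilon>_def)
  have V: "V \<le> \<Phi> y" if "y \<in> C" for y unfolding V_def using bdd that by (intro cINF_lower)
  have "\<exists>y\<in>C. \<Phi> y < V + \<epsilon> n" for n
    using cInf_lessD[of "\<Phi> ` C" "V + \<epsilon> n"] C \<epsilon>[of n] by (auto simp: V_def)
  then obtain y where y: "\<And>n. y n \<in> C" "\<And>n. \<Phi> (y n) < V + \<epsilon> n" by metis
  have near: "\<beta> * (dist (y m) (y n))\<^sup>2 \<le> \<epsilon> N" if "m \<ge> N" "n \<ge> N" for m n N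
  proof -
    obtain z where z: "z \<in> C" "\<Phi> z \<le> (\<Phi> (y m) + \<Phi> (y n)) / 2 - \<beta> * (dist (y m) (y n))\<^sup>2"
      using mid y by meson
    have "\<epsilon> m \<le> \<epsilon> N" "\<epsilon> n \<le> \<epsilon> N"
      using that by (auto simp: \<epsilon>_def intro!: le_imp_inverse_le)
    then show ?thesis using z(2) V[OF z(1)] y(2)[of m] y(2)[of n] by argo
  qed
  have "Cauchy y"
  proof (rule metric_CauchyI)
    fix e :: real assume e: "e > 0"
    then have "\<beta> * e\<^sup>2 > 0" using \<beta> by simp
    then obtain N where N: "\<epsilon> N < \<beta> * e\<^sup>2" using reals_Archimedean unfolding \<epsilon>_def by blast
    show "\<exists>M. \<forall>m\<ge>M. \<forall>n\<ge>M. dist (y m) (y n) < e"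
    proof (intro exI allI impI)
      fix m n assume mn: "m \<ge> N" "n \<ge> N"
      have "\<beta> * (dist (y m) (y n))\<^sup>2 < \<beta> * e\<^sup>2" by (rule le_less_trans[OF near[OF mn] N])
      then have "(dist (y m) (y n))\<^sup>2 < e\<^sup>2" by (simp only: mult_less_cancel_left_pos[OF \<beta>])
      then show "dist (y m) (y n) < e" by (rule power2_less_imp_less) (use e in simp)
    qed
  qed
  then obtain b where b: "y \<longlonglongrightarrow> b" using Cauchy_convergent_iff convergent_def by blast
  have bC: "b \<in> C" using closed_sequentially[OF C(1)] y(1) b by blast
  have "(\<lambda>n. \<Phi> (y n)) \<longlonglongrightarrow> \<Phi> b"
    using continuous_on_tendsto_compose[OF cont b bC] y(1) by simp
  moreover have "(\<lambda>n. V + \<epsilon> n) \<longlonglongrightarrow> V + 0"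
    unfolding \<epsilon>_def by (intro tendsto_intros LIMSEQ_inverse_real_of_nat)
  ultimately have "\<Phi> b \<le> V + 0"
    by (rule LIMSEQ_le) (use y(2) less_imp_le in blast)
  then have bV: "\<Phi> b \<le> \<Phi> z" if "z \<in> C" for z using V[OF that] by simp
  show ?thesis
  proof (rule that[OF bC])
    fix z assume z: "z \<in> C"
    obtain m where "m \<in> C" "\<Phi> m \<le> (\<Phi> b + \<Phi> z) / 2 - \<beta> * (dist b z)\<^sup>2" using mid bC z by meson
    then show "\<Phi> b + 2 * \<beta> * (dist b z)\<^sup>2 \<le> \<Phi> z" using bV[of m] by (simp add: field_simps)
  qed
qed

text \<open>A minimax principle without compactness: nearly maximal values of the minimum over the convex
  family have nearly equal minimizers, by strong convexity.\<close>

lemma strongly_convex_minimax: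
  fixes C :: "'a::complete_space set" and F :: "('a \<Rightarrow> real) set"
  assumes C: "closed C" and F: "F \<noteq> {}" and \<alpha>: "\<alpha> > 0"
    and conv: "\<And>\<Phi> \<Psi> t. \<Phi> \<in> F \<Longrightarrow> \<Psi> \<in> F \<Longrightarrow> 0 \<le> t \<Longrightarrow> t \<le> 1 \<Longrightarrow> (\<lambda>y. (1 - t) * \<Phi> y + t * \<Psi> y) \<in> F"
    and cont: "\<And>\<Phi>. \<Phi> \<in> F \<Longrightarrow> continuous_on C \<Phi>"
    and min: "\<And>\<Phi>. \<Phi> \<in> F \<Longrightarrow> \<exists>b\<in>C. \<Phi> b \<le> 0 \<and> (\<forall>y\<in>C. \<Phi> b + \<alpha> * (dist b y)\<^sup>2 \<le> \<Phi> y)"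
  shows "\<exists>y\<in>C. \<forall>\<Phi>\<in>F. \<Phi> y \<le> 0"
proof -
  obtain b where b: "\<And>\<Phi>. \<Phi> \<in> F \<Longrightarrow> b \<Phi> \<in> C" "\<And>\<Phi>. \<Phi> \<in> F \<Longrightarrow> \<Phi> (b \<Phi>) \<le> 0"
    "\<And>\<Phi> y. \<Phi> \<in> F \<Longrightarrow> y \<in> C \<Longrightarrow> \<Phi> (b \<Phi>) + \<alpha> * (dist (b \<Phi>) y)\<^sup>2 \<le> \<Phi> y"
    using min by metis
  define v where "v \<Phi> = \<Phi> (b \<Phi>)" for \<Phi>
  define V where "V = Sup (v ` F)"
  have bdd: "bdd_above (v ` F)" using b(2) unfolding v_def by (intro bdd_aboveI2)
  have vV: "v \<Phi> \<le> V" if "\<Phi> \<in> F" for \<Phi> unfolding V_def using bdd that by (intro cSUP_upper)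
  have V0: "V \<le> 0" unfolding V_def using F b(2) by (intro cSUP_least) (auto simp: v_def)
  \<comment> \<open>The double \<open>Suc\<close> gives \<open>\<tau> n \<le> 1 / 2\<close>, so
    \<open>1 - \<tau> n\<close> stays away from 0. Near maximality is demanded up to the square of
    \<open>\<tau> n\<close>, which remains small after division by the mixing weight
    \<open>\<tau> n\<close>.\<close>
  define \<tau> where "\<tau> n = inverse (real (Suc (Suc n)))" for n
  have \<tau>: "0 < \<tau> n" "\<tau> n \<le> 1 / 2" for n by (auto simp: \<tau>_def field_simps)
  have \<tau>_mono: "\<tau> n \<le> \<tau> m" if "m \<le> n" for m n
    using that unfolding \<tau>_def by (intro le_imp_inverse_le) auto
  have \<tau>_lim: "\<tau> \<longlonglongrightarrow> 0"
    unfolding \<tau>_def using LIMSEQ_Suc[OF LIMSEQ_inverse_real_of_nat] .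
  have "\<exists>\<Phi>\<in>F. V - (\<tau> n)\<^sup>2 < v \<Phi>" for n
    using less_cSupD[of "v ` F" "V - (\<tau> n)\<^sup>2"] F \<tau>(1)[of n] by (auto simp: V_def)
  then obtain \<Phi> where \<Phi>: "\<And>n. \<Phi> n \<in> F" "\<And>n. V - (\<tau> n)\<^sup>2 < v (\<Phi> n)" by metis
  define y where "y n = b (\<Phi> n)" for n
  have yC: "y n \<in> C" for n unfolding y_def by (rule b(1)[OF \<Phi>(1)])
  \<comment> \<open>The witness is the minimizer of the mixture: its value is at most
    \<open>V\<close>, while the nearly maximal member grows quadratically away from
    \<open>y n\<close>.\<close>
  have key: "\<exists>z\<in>C. (1 - t) * (V - (\<tau> n)\<^sup>2 + \<alpha> * (dist (y n) z)\<^sup>2) + t * \<Psi> z \<le> V"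
    if "\<Psi> \<in> F" "0 \<le> t" "t \<le> 1" for \<Psi> t n
  proof -
    define \<Theta> where "\<Theta> = (\<lambda>y. (1 - t) * \<Phi> n y + t * \<Psi> y)"
    have \<Theta>: "\<Theta> \<in> F" unfolding \<Theta>_def using \<Phi>(1) that by (intro conv)
    have "V - (\<tau> n)\<^sup>2 + \<alpha> * (dist (y n) (b \<Theta>))\<^sup>2 \<le> \<Phi> n (b \<Theta>)"
      using b(3)[OF \<Phi>(1) b(1)[OF \<Theta>], of n] \<Phi>(2)[of n] by (simp add: y_def v_def)
    then have "(1 - t) * (V - (\<tau> n)\<^sup>2 + \<alpha> * (dist (y n) (b \<Theta>))\<^sup>2) \<le> (1 - t) * \<Phi> n (b \<Theta>)"
      using that by (intro mult_left_mono) auto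
    moreover have "\<Theta> (b \<Theta>) \<le> V" using vV[OF \<Theta>] by (simp add: v_def)
    ultimately show ?thesis using b(1)[OF \<Theta>] by (intro bexI[of _ "b \<Theta>"]) (simp add: \<Theta>_def)
  qed
  define s where "s = sqrt (2 / \<alpha>)"
  have s: "s > 0" using \<alpha> by (simp add: s_def)
  have near: "dist (y m) (y n) \<le> 2 * s * \<tau> N" if mn: "m \<ge> N" "n \<ge> N" for m n N
  proof -
    obtain z where z: "z \<in> C" "(1 - 1 / 2) * (V - (\<tau> n)\<^sup>2 + \<alpha> * (dist (y n) z)\<^sup>2) + 1 / 2 * \<Phi> m z \<le> V"
      using key[OF \<Phi>(1)[of m], of "1 / 2" n] by auto
    have "V - (\<tau> m)\<^sup>2 + \<alpha> * (dist (y m) z)\<^sup>2 \<le> \<Phi> m z"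
      using b(3)[OF \<Phi>(1) z(1), of m] \<Phi>(2)[of m] by (simp add: y_def v_def)
    moreover have "(\<tau> m)\<^sup>2 \<le> (\<tau> N)\<^sup>2" "(\<tau> n)\<^sup>2 \<le> (\<tau> N)\<^sup>2"
      using power_mono[OF \<tau>_mono less_imp_le[OF \<tau>(1)]] mn by blast+
    ultimately have "\<alpha> * (dist (y m) z)\<^sup>2 + \<alpha> * (dist (y n) z)\<^sup>2 \<le> 2 * (\<tau> N)\<^sup>2"
      using z(2) by (simp add: field_simps)
    moreover have "0 \<le> \<alpha> * (dist (y m) z)\<^sup>2" "0 \<le> \<alpha> * (dist (y n) z)\<^sup>2" using \<alpha> by simp_all
    moreover have d: "d \<le> s * \<tau> N" if "\<alpha> * d\<^sup>2 \<le> 2 * (\<tau> N)\<^sup>2" for d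
    proof (rule power2_le_imp_le)
      show "d\<^sup>2 \<le> (s * \<tau> N)\<^sup>2" using that \<alpha> by (simp add: s_def power_mult_distrib field_simps)
    qed (use s \<tau>(1)[of N] in simp)
    ultimately have "dist (y m) z \<le> s * \<tau> N" "dist (y n) z \<le> s * \<tau> N"
      by (smt (verit) d)+
    then show ?thesis using dist_triangle2[of "y m" "y n" z] by simp
  qed
  have "Cauchy y"
  proof (rule metric_CauchyI)
    fix e :: real assume e: "e > 0"
    have "(\<lambda>n. 2 * s * \<tau> n) \<longlonglongrightarrow> 2 * s * 0" by (intro tendsto_intros \<tau>_lim)
    then have "\<forall>\<^sub>F n in sequentially. 2 * s * \<tau> n < e" using e by (intro order_tendstoD) auto
    then obtain N where "2 * s * \<tau> N < e" by (auto simp: eventually_sequentially)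
    then show "\<exists>M. \<forall>m\<ge>M. \<forall>n\<ge>M. dist (y m) (y n) < e"
      using le_less_trans[OF near] by blast
  qed
  then obtain a where a: "y \<longlonglongrightarrow> a" using Cauchy_convergent_iff convergent_def by blast
  have aC: "a \<in> C" using closed_sequentially[OF C] yC a by blast
  have "\<Psi> a \<le> 0" if \<Psi>: "\<Psi> \<in> F" for \<Psi>
  proof -
    \<comment> \<open>Mixing in \<open>\<Psi>\<close> with weight \<open>\<tau> n\<close> gives
      points \<open>z n\<close>. Dividing by \<open>\<tau> n\<close> bounds
      \<open>\<Psi> (z n)\<close> by \<open>\<tau> n\<close>, and since \<open>\<Psi>\<close> is
      bounded below on \<open>C\<close>, the vanishing weight forces \<open>z n\<close> towards
      \<open>y n\<close>.\<close>
    have "\<forall>n. \<exists>z\<in>C. (1 - \<tau> n) * (V - (\<tau> n)\<^sup>2 + \<alpha> * (dist (y n) z)\<^sup>2) + \<tau> n * \<Psi> z \<le> V"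
    proof
      fix n show "\<exists>z\<in>C. (1 - \<tau> n) * (V - (\<tau> n)\<^sup>2 + \<alpha> * (dist (y n) z)\<^sup>2) + \<tau> n * \<Psi> z \<le> V"
        using key[OF \<Psi>, of "\<tau> n" n] \<tau>[of n] by auto
    qed
    then obtain z where z: "\<And>n. z n \<in> C"
      "\<And>n. (1 - \<tau> n) * (V - (\<tau> n)\<^sup>2 + \<alpha> * (dist (y n) (z n))\<^sup>2) + \<tau> n * \<Psi> (z n) \<le> V" by metis
    have small: "(1 - \<tau> n) * (\<tau> n)\<^sup>2 \<le> \<tau> n * \<tau> n" for n
      using \<tau>[of n] by (simp add: power2_eq_square mult_le_cancel_right1)
    have \<Psi>z: "\<Psi> (z n) \<le> \<tau> n" for n
    proof -
      have "0 \<le> (1 - \<tau> n) * (\<alpha> * (dist (y n) (z n))\<^sup>2)" using \<tau>[of n] \<alpha> by simp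
      then have "\<tau> n * \<Psi> (z n) \<le> \<tau> n * V + \<tau> n * \<tau> n"
        using z(2)[of n] small[of n] by (simp add: algebra_simps)
      also have "\<dots> \<le> \<tau> n * \<tau> n" using V0 \<tau>(1)[of n] by (simp add: mult_le_0_iff)
      finally show ?thesis using \<tau>(1)[of n] by simp
    qed
    define c where "c = V - v \<Psi> + 1"
    have dyz: "dist (y n) (z n) \<le> sqrt (2 * c / \<alpha> * \<tau> n)" for n
    proof -
      have "v \<Psi> \<le> \<Psi> (z n)" using b(3)[OF \<Psi> z(1)] \<alpha> by (smt (verit) v_def zero_le_mult_iff zero_le_power2)
      then have "\<tau> n * v \<Psi> \<le> \<tau> n * \<Psi> (z n)" using \<tau>(1)[of n] by simp
      moreover have "\<tau> n * \<tau> n \<le> \<tau> n * 1" using \<tau>[of n] by (intro mult_left_mono) auto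
      ultimately have "(1 - \<tau> n) * (\<alpha> * (dist (y n) (z n))\<^sup>2) \<le> \<tau> n * c"
        using z(2)[of n] small[of n] by (simp add: c_def algebra_simps)
      moreover have "1 / 2 * (\<alpha> * (dist (y n) (z n))\<^sup>2) \<le> (1 - \<tau> n) * (\<alpha> * (dist (y n) (z n))\<^sup>2)"
        using \<tau>[of n] \<alpha> by (intro mult_right_mono) auto
      ultimately have "1 / 2 * (\<alpha> * (dist (y n) (z n))\<^sup>2) \<le> \<tau> n * c" by (rule order_trans[rotated])
      then have "(dist (y n) (z n))\<^sup>2 \<le> 2 * c / \<alpha> * \<tau> n" using \<alpha> by (simp add: field_simps)
      then show ?thesis by (rule real_le_rsqrt)
    qed
    have "(\<lambda>n. sqrt (2 * c / \<alpha> * \<tau> n)) \<longlonglongrightarrow> sqrt (2 * c / \<alpha> * 0)"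
      by (intro tendsto_real_sqrt tendsto_mult_left \<tau>_lim)
    then have "(\<lambda>n. sqrt (2 * c / \<alpha> * \<tau> n)) \<longlonglongrightarrow> 0" by simp
    then have "(\<lambda>n. dist (y n) (z n)) \<longlonglongrightarrow> 0"
      by (rule Lim_null_comparison[rotated]) (intro always_eventually allI, simp only: real_norm_def abs_of_nonneg zero_le_dist dyz)
    then have "(\<lambda>n. dist (y n) (z n) + dist (y n) a) \<longlonglongrightarrow> 0 + 0"
      by (rule tendsto_add) (rule tendsto_dist_iff[THEN iffD1, OF a])
    then have "(\<lambda>n. dist (z n) a) \<longlonglongrightarrow> 0"
      unfolding add_0
      by (rule Lim_null_comparison[rotated]) (intro always_eventually allI, simp only: real_norm_def abs_of_nonneg zero_le_dist dist_triangle3)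
    then have "z \<longlonglongrightarrow> a" by (rule tendsto_dist_iff[THEN iffD2])
    then have "(\<lambda>n. \<Psi> (z n)) \<longlonglongrightarrow> \<Psi> a"
      by (rule continuous_on_tendsto_compose[OF cont[OF \<Psi>] _ aC]) (simp add: z(1))
    then show ?thesis using \<tau>_lim by (rule LIMSEQ_le) (intro exI[of _ 0] allI impI \<Psi>z)
  qed
  then show ?thesis using aC by blast
qed

subsection \<open>Barycenters and intersections of balls\<close>

text \<open>First variation at the minimizer: \<open>\<Theta>\<close> plays the part of minus the
  directional derivative of \<open>\<Phi>\<close> at \<open>b\<close>. On a short segment minimality
  makes it at most quadratic in the length, whereas comparison bounds it below by a linear multiple
  of \<open>\<Theta> y\<close>; hence \<open>\<Theta> y \<le> 0\<close>.\<close>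

lemma CAT_variance:
  fixes b y :: "'b::metric_space" and p :: "'i \<Rightarrow> 'b"
  assumes q: "q \<ge> 0" and Y: "CAT (- q) (UNIV :: 'b set)" and C: "geo_convex C"
    and c: "\<And>i. i \<in> S \<Longrightarrow> c i \<ge> 0"
  defines "\<Phi> \<equiv> \<lambda>y. \<Sum>i\<in>S. c i * md q (dist y (p i))"
  assumes b: "b \<in> C" "\<And>y. y \<in> C \<Longrightarrow> \<Phi> b \<le> \<Phi> y" and y: "y \<in> C"
  shows "\<Phi> b + md q (dist b y) * (sum c S + q * \<Phi> b) \<le> \<Phi> y"
proof (cases "b = y")
  case False
  define l where "l = dist b y"
  have l: "l > 0" using False by (simp add: l_def)
  obtain \<gamma> where g: "geodesic \<gamma> b y" using CAT_geodesic[OF Y] by blast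
  define W where "W = sum c S + q * \<Phi> b"
  have \<Phi>0: "\<Phi> u \<ge> 0" for u unfolding \<Phi>_def using c q by (intro sum_nonneg) (auto simp: md_nonneg)
  have W: "W \<ge> 0" unfolding W_def using c q \<Phi>0 by (simp add: sum_nonneg)
  define \<Theta> where "\<Theta> u = (\<Sum>i\<in>S. c i * apex q b u (p i))" for u
  have \<Theta>: "\<Theta> u = md q (dist b u) * W + \<Phi> b - \<Phi> u" for u
    unfolding \<Theta>_def apex_def W_def \<Phi>_def
    by (simp add: algebra_simps sum.distrib sum_subtractf sum_distrib_left) (simp add: sum_distrib_right)
  have key: "\<Theta> y \<le> sn q l * W * w" if w: "0 < w" "w \<le> sn q (l / 2)" for w
  proof -
    obtain a where a: "a \<ge> 0" "sn q a = w" using sn_surj[OF q, of w] w by auto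
    have al: "2 * a \<le> l"
    proof (rule ccontr)
      assume "\<not> 2 * a \<le> l"
      then have "sn q (l / 2) < sn q a" by (intro sn_strict_mono q) auto
      then show False using w a by simp
    qed
    have "sn q (2 * a) * \<Theta> y \<le> sn q l * \<Theta> (\<gamma> (2 * a))"
    proof -
      have "sn q (2 * a) * (c i * apex q b y (p i)) \<le> sn q l * (c i * apex q b (\<gamma> (2 * a)) (p i))" if "i \<in> S" for i
        using mult_left_mono[OF CAT_apex[OF q Y g, of "2 * a" "p i"] c[OF that]] a al
        by (simp add: l_def algebra_simps)
      then show ?thesis unfolding \<Theta>_def sum_distrib_left by (rule sum_mono)
    qed
    also have "\<Theta> (\<gamma> (2 * a)) \<le> md q (2 * a) * W"
    proof -
      have "\<gamma> (2 * a) \<in> C" using geo_convexD[OF C b(1) y g] a al by (simp add: l_def)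
      moreover have "dist b (\<gamma> (2 * a)) = 2 * a" using geodesic_dist(1)[OF g] a al by (simp add: l_def)
      ultimately show ?thesis using b(2) by (simp add: \<Theta>)
    qed
    also have "md q (2 * a) = 2 * w\<^sup>2" using md_double[OF q, of a] sn_square[OF q, of a] a by simp
    finally have "sn q (2 * a) * \<Theta> y \<le> sn q l * (2 * w\<^sup>2 * W)" using q l by (simp add: sn_nonneg mult_left_mono)
    then have le: "(2 * w) * ((1 + q * md q a) * \<Theta> y) \<le> (2 * w) * (sn q l * W * w)"
      unfolding sn_double[OF q] a(2) by (simp add: power2_eq_square algebra_simps)
    then have "(1 + q * md q a) * \<Theta> y \<le> sn q l * W * w"
      by (rule mult_left_le_imp_le) (use w in simp)
    show ?thesis
    proof (cases "\<Theta> y \<ge> 0")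
      case True
      have "1 * \<Theta> y \<le> (1 + q * md q a) * \<Theta> y" using True q by (intro mult_right_mono) (auto simp: md_nonneg)
      then show ?thesis using \<open>(1 + q * md q a) * \<Theta> y \<le> sn q l * W * w\<close> by simp
    next
      case False
      moreover have "0 \<le> sn q l * W * w" using q l W w by (simp add: sn_nonneg)
      ultimately show ?thesis by linarith
    qed
  qed
  have "\<Theta> y \<le> 0"
  proof (rule ccontr)
    assume "\<not> \<Theta> y \<le> 0"
    then have pos: "\<Theta> y > 0" by simp
    have snl: "sn q l > 0" "sn q (l / 2) > 0" using q l by (auto intro!: sn_pos)
    define w where "w = min (sn q (l / 2)) (\<Theta> y / (2 * (sn q l * (W + 1))))"
    have w: "0 < w" "w \<le> sn q (l / 2)" using pos snl W by (auto simp: w_def)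
    define X where "X = sn q l * (W + 1)"
    have X: "X > 0" using snl W by (simp add: X_def)
    have "sn q l * W * w \<le> sn q l * (W + 1) * (\<Theta> y / (2 * (sn q l * (W + 1))))"
      using snl W w by (intro mult_mono) (auto simp: w_def)
    also have "\<dots> = \<Theta> y / 2" unfolding X_def[symmetric] using X by simp
    finally show False using key[OF w] pos by simp
  qed
  then show ?thesis unfolding \<Theta> by (simp add: W_def)
qed simp

text \<open>Averaging the variance inequality over the points \<open>p j\<close> themselves bounds
  \<open>2 * \<Phi> b + q * (\<Phi> b)\<^sup>2\<close> by the double sum of pairwise terms. The map
  from \<open>t\<close> to \<open>2 * t + q * t\<^sup>2\<close> is increasing for nonnegative
  \<open>t\<close>, which explains the form of the hypothesis on \<open>R\<close>.\<close>

lemma CAT_barycenter: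
  fixes p :: "'i \<Rightarrow> 'b::complete_space"
  assumes q: "q \<ge> 0" and Y: "CAT (- q) (UNIV :: 'b set)" and C: "geo_convex C" "closed C"
    and S: "finite S" "\<And>i. i \<in> S \<Longrightarrow> p i \<in> C" and c: "\<And>i. i \<in> S \<Longrightarrow> c i \<ge> 0" "sum c S = 1"
    and R: "R \<ge> 0" "(\<Sum>i\<in>S. \<Sum>j\<in>S. c i * c j * md q (dist (p i) (p j))) \<le> 2 * R + q * R\<^sup>2"
  defines "\<Phi> \<equiv> \<lambda>y. \<Sum>i\<in>S. c i * md q (dist y (p i))"
  shows "\<exists>b\<in>C. \<Phi> b \<le> R \<and> (\<forall>y\<in>C. \<Phi> b + 1 / 4 * (dist b y)\<^sup>2 \<le> \<Phi> y)"
proof -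
  have "S \<noteq> {}" using c(2) by auto
  then have Cne: "C \<noteq> {}" using S(2) by auto
  have \<Phi>0: "\<Phi> u \<ge> 0" for u unfolding \<Phi>_def using c q by (intro sum_nonneg) (auto simp: md_nonneg)
  have "continuous_on C \<Phi>" unfolding \<Phi>_def by (intro continuous_intros)
  moreover have "bdd_below (\<Phi> ` C)" using \<Phi>0 by (intro bdd_belowI2)
  \<comment> \<open>The constant 1/8 comes from \<open>md_ge_square\<close> at half the distance. It
    does not depend on the weights, as these sum to one; the minimax step requires this
    uniformity.\<close>
  moreover have "\<exists>m\<in>C. \<Phi> m \<le> (\<Phi> y + \<Phi> z) / 2 - 1 / 8 * (dist y z)\<^sup>2" if yz: "y \<in> C" "z \<in> C" for y z
  proof -
    obtain \<gamma> where g: "geodesic \<gamma> y z" using CAT_geodesic[OF Y] by blast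
    define m where "m = \<gamma> (dist y z / 2)"
    define e where "e = md q (dist y z / 2)"
    have m: "m \<in> C" unfolding m_def using geo_convexD[OF C(1) yz g] by simp
    have e: "e \<ge> (dist y z)\<^sup>2 / 8"
      using md_ge_square[OF q, of "dist y z / 2"] by (simp add: e_def power_divide)
    have e0: "e \<ge> 0" using q by (simp add: e_def md_nonneg)
    have le: "md q (dist m v) \<le> (md q (dist y v) + md q (dist z v)) / 2 - (dist y z)\<^sup>2 / 8" for v
    proof -
      have "2 * (1 + q * e) * md q (dist m v) + 2 * e \<le> md q (dist y v) + md q (dist z v)"
        using CAT_midpoint[OF q Y g, of v] by (simp add: m_def e_def)
      moreover have "2 * md q (dist m v) \<le> 2 * (1 + q * e) * md q (dist m v)"
        using q e0 by (intro mult_right_mono) (auto simp: md_nonneg)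
      ultimately show ?thesis using e by argo
    qed
    have "\<Phi> m \<le> (\<Sum>i\<in>S. c i * ((md q (dist y (p i)) + md q (dist z (p i))) / 2 - (dist y z)\<^sup>2 / 8))"
      unfolding \<Phi>_def by (intro sum_mono mult_left_mono le c)
    also have "\<dots> = (\<Phi> y + \<Phi> z) / 2 - sum c S * ((dist y z)\<^sup>2 / 8)"
      unfolding \<Phi>_def
      by (simp add: right_diff_distrib sum_subtractf sum_distrib_right sum.distrib[symmetric] sum_divide_distrib distrib_left)
    finally show ?thesis using m c by (intro bexI[of _ m]) auto
  qed
  ultimately obtain b where b: "b \<in> C" "\<And>y. y \<in> C \<Longrightarrow> \<Phi> b + 2 * (1 / 8) * (dist b y)\<^sup>2 \<le> \<Phi> y"
    using strongly_convex_minimizer[OF C(2) Cne, of \<Phi> "1 / 8"] by auto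
  have min: "\<Phi> b \<le> \<Phi> y" if "y \<in> C" for y by (rule order_trans[OF _ b(2)[OF that]]) simp
  have var: "\<Phi> b + md q (dist b y) * (1 + q * \<Phi> b) \<le> \<Phi> y" if "y \<in> C" for y
    using CAT_variance[where c = c and S = S and p = p, OF q Y C(1) c(1) b(1) _ that] min c(2) by (simp add: \<Phi>_def)
  have "2 * \<Phi> b + q * (\<Phi> b)\<^sup>2 = \<Phi> b * sum c S + \<Phi> b * (1 + q * \<Phi> b)"
    using c(2) by (simp add: power2_eq_square algebra_simps)
  also have "\<dots> = (\<Sum>j\<in>S. c j * (\<Phi> b + md q (dist b (p j)) * (1 + q * \<Phi> b)))"
    by (subst (2) \<Phi>_def) (simp add: sum_distrib_left sum_distrib_right distrib_left sum.distrib mult_ac)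
  also have "\<dots> \<le> (\<Sum>j\<in>S. c j * \<Phi> (p j))"
    by (intro sum_mono mult_left_mono c var S)
  also have "\<dots> \<le> 2 * R + q * R\<^sup>2"
    using R(2) by (simp add: \<Phi>_def sum_distrib_left mult_ac dist_commute)
  finally have le: "2 * \<Phi> b + q * (\<Phi> b)\<^sup>2 \<le> 2 * R + q * R\<^sup>2" .
  have "\<Phi> b \<le> R"
  proof (rule ccontr)
    assume "\<not> \<Phi> b \<le> R"
    then have gt: "R < \<Phi> b" by simp
    then have "R\<^sup>2 \<le> (\<Phi> b)\<^sup>2" using R(1) by (intro power_mono) auto
    then have "q * R\<^sup>2 \<le> q * (\<Phi> b)\<^sup>2" using q by (rule mult_left_mono)
    then show False using le gt by simp
  qed
  then show ?thesis using b by auto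
qed

text \<open>Finitely supported averages of the ball conditions form a convex family, and each has a
  minimizer of nonpositive value by the barycenter estimate. The minimax principle gives one point
  for all averages; those concentrated at one index are the balls.\<close>

theorem CAT_ball_intersection:
  fixes p :: "'i \<Rightarrow> 'b::complete_space"
  assumes q: "q \<ge> 0" and Y: "CAT (- q) (UNIV :: 'b set)" and C: "geo_convex C" "closed C" "C \<noteq> {}"
    and J: "\<And>i. i \<in> J \<Longrightarrow> p i \<in> C" "\<And>i. i \<in> J \<Longrightarrow> e i \<ge> 0"
    and kernel: "\<And>S c. finite S \<Longrightarrow> S \<subseteq> J \<Longrightarrow> (\<And>i. i \<in> S \<Longrightarrow> c i \<ge> 0) \<Longrightarrow> sum c S = 1 \<Longrightarrow>
      (\<Sum>i\<in>S. \<Sum>j\<in>S. c i * c j * md q (dist (p i) (p j))) \<le> 2 * (\<Sum>i\<in>S. c i * e i) + q * (\<Sum>i\<in>S. c i * e i)\<^sup>2"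
  shows "\<exists>y\<in>C. \<forall>i\<in>J. md q (dist y (p i)) \<le> e i"
proof (cases "J = {}")
  case True
  then show ?thesis using C(3) by auto
next
  case False
  define G where "G S c = (\<lambda>y. \<Sum>i\<in>S. c i * (md q (dist y (p i)) - e i))" for S and c :: "'i \<Rightarrow> real"
  define F where "F = {G S c | S c. finite S \<and> S \<subseteq> J \<and> (\<forall>i\<in>S. c i \<ge> 0) \<and> sum c S = 1}"
  have single: "(\<lambda>y. md q (dist y (p i)) - e i) \<in> F" if "i \<in> J" for i
    unfolding F_def G_def using that by (auto intro!: exI[of _ "{i}"] exI[of _ "\<lambda>_. 1"])
  have "\<exists>y\<in>C. \<forall>\<Phi>\<in>F. \<Phi> y \<le> 0"
  proof (rule strongly_convex_minimax[OF C(2), of F "1 / 4"])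
    show "F \<noteq> {}" using single False by blast
  next
    fix \<Phi> \<Psi> and t :: real assume "\<Phi> \<in> F" "\<Psi> \<in> F" and t: "0 \<le> t" "t \<le> 1"
    then obtain S c S' c' where S: "\<Phi> = G S c" "finite S" "S \<subseteq> J" "\<forall>i\<in>S. c i \<ge> 0" "sum c S = 1"
      and S': "\<Psi> = G S' c'" "finite S'" "S' \<subseteq> J" "\<forall>i\<in>S'. c' i \<ge> 0" "sum c' S' = 1"
      unfolding F_def by blast
    define d where "d i = (1 - t) * (if i \<in> S then c i else 0) + t * (if i \<in> S' then c' i else 0)" for i
    have d: "(\<Sum>i\<in>S \<union> S'. d i * f i) = (1 - t) * (\<Sum>i\<in>S. c i * f i) + t * (\<Sum>i\<in>S'. c' i * f i)" for f
    proof -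
      have 1: "(\<Sum>i\<in>S. c i * f i) = (\<Sum>i\<in>S \<union> S'. if i \<in> S then c i * f i else 0)"
        using S S' by (subst sum.inter_restrict[symmetric]) (auto simp: Int_absorb1)
      have 2: "(\<Sum>i\<in>S'. c' i * f i) = (\<Sum>i\<in>S \<union> S'. if i \<in> S' then c' i * f i else 0)"
        using S S' by (subst sum.inter_restrict[symmetric]) (auto simp: Int_absorb1)
      show ?thesis unfolding 1 2 sum_distrib_left sum.distrib[symmetric]
        by (intro sum.cong) (auto simp: d_def algebra_simps)
    qed
    have "(\<lambda>y. (1 - t) * \<Phi> y + t * \<Psi> y) = G (S \<union> S') d"
      unfolding S(1) S'(1) G_def d ..
    moreover have "sum d (S \<union> S') = 1" using d[of "\<lambda>_. 1"] S S' by simp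
    moreover have "\<forall>i\<in>S \<union> S'. d i \<ge> 0" using S S' t by (auto simp: d_def)
    ultimately show "(\<lambda>y. (1 - t) * \<Phi> y + t * \<Psi> y) \<in> F"
      unfolding F_def using S S' by blast
  next
    fix \<Phi> assume "\<Phi> \<in> F"
    then obtain S c where S: "\<Phi> = G S c" "finite S" "S \<subseteq> J" "\<And>i. i \<in> S \<Longrightarrow> c i \<ge> 0" "sum c S = 1"
      unfolding F_def by blast
    show "continuous_on C \<Phi>" unfolding S(1) G_def by (intro continuous_intros)
    define R where "R = (\<Sum>i\<in>S. c i * e i)"
    have R: "R \<ge> 0" unfolding R_def using S J by (intro sum_nonneg) auto
    have \<Phi>: "\<Phi> y = (\<Sum>i\<in>S. c i * md q (dist y (p i))) - R" for y
      unfolding S(1) G_def R_def by (simp add: right_diff_distrib sum_subtractf)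
    have "\<exists>b\<in>C. (\<Sum>i\<in>S. c i * md q (dist b (p i))) \<le> R \<and>
       (\<forall>y\<in>C. (\<Sum>i\<in>S. c i * md q (dist b (p i))) + 1 / 4 * (dist b y)\<^sup>2 \<le> (\<Sum>i\<in>S. c i * md q (dist y (p i))))"
      using S J kernel[OF S(2,3,4,5)] R by (intro CAT_barycenter[OF q Y C(1,2)]) (auto simp: R_def)
    then show "\<exists>b\<in>C. \<Phi> b \<le> 0 \<and> (\<forall>y\<in>C. \<Phi> b + 1 / 4 * (dist b y)\<^sup>2 \<le> \<Phi> y)"
      unfolding \<Phi> by auto
  qed simp
  then obtain y where "y \<in> C" "\<forall>\<Phi>\<in>F. \<Phi> y \<le> 0" by blast
  then show ?thesis using single by (intro bexI[of _ y]) force+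
qed

section \<open>Midpoint convexity and quadrilaterals\<close>

text \<open>The parameters mapped into \<open>N\<close> form a closed set containing both ends and
  all its midpoints; the midpoint of a gap would lie in the gap.\<close>

lemma geo_convex_midpoint:
  fixes N :: "'b::metric_space set"
  assumes N: "closed N"
    and mid: "\<And>x y \<gamma>. x \<in> N \<Longrightarrow> y \<in> N \<Longrightarrow> geodesic \<gamma> x y \<Longrightarrow> \<gamma> (dist x y / 2) \<in> N"
  shows "geo_convex N"
  unfolding geo_convex_def
proof (intro ballI allI impI)
  fix x y \<gamma> assume xy: "x \<in> N" "y \<in> N" and g: "geodesic \<gamma> x y"
  define l where "l = dist x y"
  have iso: "dist (\<gamma> s) (\<gamma> t) = \<bar>s - t\<bar>" if "s \<in> {0..l}" "t \<in> {0..l}" for s t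
    using g that unfolding geodesic_def l_def by blast
  have ends: "\<gamma> 0 = x" "\<gamma> l = y" using g unfolding geodesic_def l_def by auto
  define T where "T = {0..l} \<inter> \<gamma> -` N"
  have "continuous_on {0..l} \<gamma>"
    unfolding continuous_on_iff using iso by (metis dist_real_def)
  then have T: "closed T" unfolding T_def by (intro continuous_closed_preimage N) auto
  have T0: "0 \<in> T" "l \<in> T" using ends xy by (auto simp: T_def l_def)
  have Tmid: "(a + b) / 2 \<in> T" if ab: "a \<in> T" "b \<in> T" "a \<le> b" for a b
  proof -
    have d: "dist (\<gamma> a) (\<gamma> b) = b - a" using iso[of a b] ab by (simp add: T_def)
    have "geodesic (\<lambda>s. \<gamma> (a + s)) (\<gamma> a) (\<gamma> b)"
      unfolding geodesic_def d using ab by (auto simp: T_def iso)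
    then have "\<gamma> (a + (b - a) / 2) \<in> N" using mid[of "\<gamma> a" "\<gamma> b"] ab unfolding d by (auto simp: T_def)
    moreover have "a + (b - a) / 2 = (a + b) / 2" by (simp add: field_simps)
    ultimately show ?thesis using ab by (auto simp: T_def)
  qed
  have "s \<in> T" if s: "s \<in> {0..l}" for s
  proof (rule ccontr)
    assume nT: "s \<notin> T"
    define A where "A = T \<inter> {0..s}"
    define B where "B = T \<inter> {s..l}"
    have "closed A" "closed B" "A \<noteq> {}" "B \<noteq> {}" "bdd_above A" "bdd_below B"
      using T T0 s by (auto simp: A_def B_def)
    then have AB: "Sup A \<in> A" "Inf B \<in> B"
      by (auto intro: closed_contains_Sup closed_contains_Inf)
    define m where "m = (Sup A + Inf B) / 2"
    have lt: "Sup A < s" "s < Inf B" using AB nT by (auto simp: A_def B_def le_less)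
    then have m: "m \<in> T" unfolding m_def using AB by (intro Tmid) (auto simp: A_def B_def)
    have "0 \<le> Sup A" "Inf B \<le> l" using AB by (auto simp: A_def B_def)
    then have "m \<in> A \<or> m \<in> B" using m lt by (auto simp: A_def B_def m_def)
    then have "m \<le> Sup A \<or> Inf B \<le> m"
      using \<open>bdd_above A\<close> \<open>bdd_below B\<close> by (meson cInf_lower cSup_upper)
    then show False using lt by (auto simp: m_def)
  qed
  then show "\<gamma> ` {0..dist x y} \<subseteq> N" by (auto simp: T_def l_def)
qed

text \<open>The median inequality at the midpoint of one diagonal is applied to the two other
  vertices, whose distance is bounded through that midpoint.\<close>

lemma CAT_quadrilateral:
  fixes x y u v :: "'b::metric_space"
  assumes q: "q \<ge> 0" and Y: "CAT (- q) (UNIV :: 'b set)"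
  shows "(dist x v)\<^sup>2 + (dist y u)\<^sup>2 \<le> (dist x u)\<^sup>2 + (dist y v)\<^sup>2 + (dist x y)\<^sup>2 + (dist u v)\<^sup>2"
proof -
  obtain \<gamma> where g: "geodesic \<gamma> x v" using CAT_geodesic[OF Y] by blast
  define m where "m = \<gamma> (dist x v / 2)"
  have "(dist y u)\<^sup>2 \<le> (dist m y + dist m u)\<^sup>2" by (intro power_mono dist_triangle3) auto
  also have "\<dots> \<le> 2 * (dist m y)\<^sup>2 + 2 * (dist m u)\<^sup>2"
    using zero_le_power2[of "dist m y - dist m u"] by (simp add: power2_eq_square algebra_simps)
  finally show ?thesis
    using CAT_midpoint_square[OF q Y g, of y] CAT_midpoint_square[OF q Y g, of u]
    by (simp add: m_def dist_commute field_simps)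
qed

text \<open>Three median inequalities leave the mixed terms of a quadrilateral, which the previous
  lemma eliminates. This quadratic form of convexity of the metric suffices for closures and
  neighbourhoods.\<close>

lemma CAT_midpoints_dist:
  fixes x y x' y' :: "'b::metric_space"
  assumes q: "q \<ge> 0" and Y: "CAT (- q) (UNIV :: 'b set)"
    and g: "geodesic \<gamma> x y" "geodesic \<gamma>' x' y'"
  shows "(dist (\<gamma> (dist x y / 2)) (\<gamma>' (dist x' y' / 2)))\<^sup>2 \<le> ((dist x x')\<^sup>2 + (dist y y')\<^sup>2) / 2"
proof -
  define m' where "m' = \<gamma>' (dist x' y' / 2)"
  have "(dist (\<gamma> (dist x y / 2)) m')\<^sup>2 \<le> ((dist x m')\<^sup>2 + (dist y m')\<^sup>2) / 2 - (dist x y)\<^sup>2 / 4"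
    by (rule CAT_midpoint_square[OF q Y g(1)])
  moreover have "(dist m' v)\<^sup>2 \<le> ((dist x' v)\<^sup>2 + (dist y' v)\<^sup>2) / 2 - (dist x' y')\<^sup>2 / 4" for v
    unfolding m'_def by (rule CAT_midpoint_square[OF q Y g(2)])
  from this[of x] this[of y] have "(dist x m')\<^sup>2 + (dist y m')\<^sup>2
     \<le> ((dist x x')\<^sup>2 + (dist x y')\<^sup>2 + (dist y x')\<^sup>2 + (dist y y')\<^sup>2) / 2 - (dist x' y')\<^sup>2 / 2"
    by (simp add: dist_commute field_simps)
  moreover have "(dist x y')\<^sup>2 + (dist y x')\<^sup>2 \<le> (dist x x')\<^sup>2 + (dist y y')\<^sup>2 + (dist x y)\<^sup>2 + (dist x' y')\<^sup>2"
    by (rule CAT_quadrilateral[OF q Y])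
  ultimately show ?thesis unfolding m'_def[symmetric] by (simp add: field_simps)
qed

lemma geo_convex_closure:
  fixes C :: "'b::metric_space set"
  assumes q: "q \<ge> 0" and Y: "CAT (- q) (UNIV :: 'b set)" and C: "geo_convex C"
  shows "geo_convex (closure C)"
proof (rule geo_convex_midpoint)
  fix x y \<gamma> assume xy: "x \<in> closure C" "y \<in> closure C" and g: "geodesic \<gamma> x y"
  show "\<gamma> (dist x y / 2) \<in> closure C"
    unfolding closure_approachable
  proof (intro allI impI)
    fix e :: real assume e: "e > 0"
    obtain x' y' where x': "x' \<in> C" "dist x' x < e" and y': "y' \<in> C" "dist y' y < e"
      using xy e unfolding closure_approachable by meson
    obtain \<gamma>' where g': "geodesic \<gamma>' x' y'" using CAT_geodesic[OF Y] by blast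
    define m' where "m' = \<gamma>' (dist x' y' / 2)"
    have "(dist m' (\<gamma> (dist x y / 2)))\<^sup>2 \<le> ((dist x' x)\<^sup>2 + (dist y' y)\<^sup>2) / 2"
      unfolding m'_def by (rule CAT_midpoints_dist[OF q Y g' g])
    also have "\<dots> < e\<^sup>2"
      using power_strict_mono[OF x'(2), of 2] power_strict_mono[OF y'(2), of 2] by simp
    finally have "dist m' (\<gamma> (dist x y / 2)) < e" by (rule power2_less_imp_less) (use e in simp)
    moreover have "m' \<in> C" unfolding m'_def using geo_convexD[OF C x'(1) y'(1) g'] by simp
    ultimately show "\<exists>z\<in>C. dist z (\<gamma> (dist x y / 2)) < e" by blast
  qed
qed simp

subsection \<open>Extension of nonexpansive maps\<close>

lemma geo_convexD': "geo_convex C \<Longrightarrow> x \<in> C \<Longrightarrow> y \<in> C \<Longrightarrow> geodesic \<gamma> x y \<Longrightarrow> \<gamma> ` {0..dist x y} \<subseteq> C"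
  unfolding geo_convex_def by blast

section \<open>Nearest point projection onto convex sets\<close>

definition nearest_point_map :: "'b::metric_space set \<Rightarrow> ('b \<Rightarrow> 'b) \<Rightarrow> bool" where
  "nearest_point_map C P \<longleftrightarrow> (\<forall>x. P x \<in> C \<and> (\<forall>y\<in>C. dist x (P x) \<le> dist x y))"

lemma nearest_point_map_exists:
  fixes C :: "'b::complete_space set"
  assumes q: "q \<ge> 0" and Y: "CAT (- q) (UNIV :: 'b set)" and C: "geo_convex C" "closed C" "C \<noteq> {}"
  obtains P where "nearest_point_map C P"
proof -
  have "\<exists>b. b \<in> C \<and> (\<forall>y\<in>C. dist x b \<le> dist x y)" for x
  proof -
    have mid: "\<exists>m\<in>C. (dist x m)\<^sup>2 \<le> ((dist x y)\<^sup>2 + (dist x z)\<^sup>2) / 2 - 1 / 4 * (dist y z)\<^sup>2" if yz: "y \<in> C" "z \<in> C" for y z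
    proof -
      obtain \<gamma> where g: "geodesic \<gamma> y z" using CAT_geodesic[OF Y] by blast
      have "\<gamma> (dist y z / 2) \<in> C" using geo_convexD[OF C(1) yz g] by simp
      then show ?thesis using CAT_midpoint_square[OF q Y g, of x] by (auto simp: dist_commute)
    qed
    have "continuous_on C (\<lambda>y. (dist x y)\<^sup>2)" by (intro continuous_intros)
    moreover have "bdd_below ((\<lambda>y. (dist x y)\<^sup>2) ` C)" by (intro bdd_belowI2[of _ 0]) simp
    ultimately obtain b where b: "b \<in> C" "\<And>y. y \<in> C \<Longrightarrow> (dist x b)\<^sup>2 + 2 * (1 / 4) * (dist b y)\<^sup>2 \<le> (dist x y)\<^sup>2"
      using strongly_convex_minimizer[OF C(2,3) _ _ _ mid] by auto
    have "dist x b \<le> dist x y" if "y \<in> C" for y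
    proof (rule power2_le_imp_le)
      show "(dist x b)\<^sup>2 \<le> (dist x y)\<^sup>2" by (rule order_trans[OF _ b(2)[OF that]]) simp
    qed simp
    then show ?thesis using b(1) by blast
  qed
  then obtain P where "\<And>x. P x \<in> C \<and> (\<forall>y\<in>C. dist x (P x) \<le> dist x y)" by metis
  then show ?thesis using that unfolding nearest_point_map_def by blast
qed

text \<open>Minimality is the inequality with coefficient 0 at the second square. Using it at the
  midpoint of the segment from \<open>P x\<close> improves a coefficient \<open>1 - r\<close> to
  \<open>1 - r / 2\<close>, and the limit is 1.\<close>

lemma nearest_point_map_pythagoras:
  fixes C :: "'b::metric_space set"
  assumes q: "q \<ge> 0" and Y: "CAT (- q) (UNIV :: 'b set)" and C: "geo_convex C"
    and P: "nearest_point_map C P" and y: "y \<in> C"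
  shows "(dist x (P x))\<^sup>2 + (dist (P x) y)\<^sup>2 \<le> (dist x y)\<^sup>2"
proof -
  have PC: "P x \<in> C" and min: "\<And>y. y \<in> C \<Longrightarrow> (dist x (P x))\<^sup>2 \<le> (dist x y)\<^sup>2"
    using P unfolding nearest_point_map_def by (auto intro!: power_mono)
  have "(dist x (P x))\<^sup>2 + (1 - (1 / 2) ^ n) * (dist (P x) z)\<^sup>2 \<le> (dist x z)\<^sup>2" if "z \<in> C" for n z
    using that
  proof (induction n arbitrary: z)
    case 0
    then show ?case using min by simp
  next
    case (Suc n)
    obtain \<gamma> where g: "geodesic \<gamma> (P x) z" using CAT_geodesic[OF Y] by blast
    define l where "l = dist (P x) z"
    define m where "m = \<gamma> (l / 2)"
    have m: "m \<in> C" unfolding m_def l_def using geo_convexD[OF C PC Suc.prems g] by simp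
    have xm: "dist (P x) m = l / 2" unfolding m_def l_def by (rule geodesic_dist(1)[OF g]) auto
    have "(dist x (P x))\<^sup>2 + (1 - (1 / 2) ^ n) * (l / 2)\<^sup>2 \<le> (dist x m)\<^sup>2"
      using Suc.IH[OF m] unfolding xm .
    moreover have "(dist x m)\<^sup>2 \<le> ((dist x (P x))\<^sup>2 + (dist x z)\<^sup>2) / 2 - l\<^sup>2 / 4"
      using CAT_midpoint_square[OF q Y g, of x] by (simp add: m_def l_def dist_commute)
    moreover define r :: real where "r = (1 / 2) ^ n"
    ultimately show ?case unfolding l_def[symmetric] power_Suc r_def[symmetric] by (simp add: field_simps)
  qed
  then have "(dist x (P x))\<^sup>2 + (1 - (1 / 2) ^ n) * (dist (P x) y)\<^sup>2 \<le> (dist x y)\<^sup>2" for n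
    using y by blast
  moreover have "(\<lambda>n. (dist x (P x))\<^sup>2 + (1 - (1 / 2) ^ n) * (dist (P x) y)\<^sup>2) \<longlonglongrightarrow> (dist x (P x))\<^sup>2 + (1 - 0) * (dist (P x) y)\<^sup>2"
    by (intro tendsto_intros LIMSEQ_power_zero) simp
  ultimately have "(dist x (P x))\<^sup>2 + (1 - 0) * (dist (P x) y)\<^sup>2 \<le> (dist x y)\<^sup>2"
    using LIMSEQ_le_const2 by blast
  then show ?thesis by simp
qed

text \<open>The right-angle inequalities at \<open>P x\<close> and \<open>P y\<close> are added; the
  quadrilateral inequality bounds the resulting diagonals.\<close>

lemma nearest_point_map_nonexpansive:
  fixes C :: "'b::metric_space set"
  assumes q: "q \<ge> 0" and Y: "CAT (- q) (UNIV :: 'b set)" and C: "geo_convex C"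
    and P: "nearest_point_map C P"
  shows "dist (P x) (P y) \<le> dist x y"
proof (rule power2_le_imp_le)
  have PC: "P x \<in> C" "P y \<in> C" using P unfolding nearest_point_map_def by auto
  show "(dist (P x) (P y))\<^sup>2 \<le> (dist x y)\<^sup>2"
    using nearest_point_map_pythagoras[OF q Y C P PC(2), of x] nearest_point_map_pythagoras[OF q Y C P PC(1), of y]
      CAT_quadrilateral[OF q Y, of x "P y" y "P x"]
    unfolding dist_commute[of "P y" "P x"] by linarith
qed simp

text \<open>The midpoint between the projections of two points lies in \<open>C\<close> and is
  within \<open>\<delta>\<close> of the midpoint between the points. So a closed hull of points
  within \<open>\<delta>\<close> of \<open>C\<close> remains within \<open>\<delta>\<close> of
  \<open>C\<close>.\<close>

lemma geo_convex_neighbourhood: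
  fixes C :: "'b::metric_space set"
  assumes q: "q \<ge> 0" and Y: "CAT (- q) (UNIV :: 'b set)" and C: "geo_convex C"
    and P: "nearest_point_map C P"
  shows "closed {y. dist y (P y) \<le> \<delta>}" "geo_convex {y. dist y (P y) \<le> \<delta>}"
proof -
  have "continuous_on UNIV P"
    unfolding continuous_on_iff using nearest_point_map_nonexpansive[OF q Y C P] by (meson le_less_trans)
  then show cl: "closed {y. dist y (P y) \<le> \<delta>}"
    by (intro closed_Collect_le continuous_intros)
  show "geo_convex {y. dist y (P y) \<le> \<delta>}"
  proof (rule geo_convex_midpoint[OF cl])
    fix x y \<gamma> assume x: "x \<in> {y. dist y (P y) \<le> \<delta>}" and y: "y \<in> {y. dist y (P y) \<le> \<delta>}" and g: "geodesic \<gamma> x y"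
    obtain \<gamma>' where g': "geodesic \<gamma>' (P x) (P y)" using CAT_geodesic[OF Y] by blast
    define m m' where "m = \<gamma> (dist x y / 2)" and "m' = \<gamma>' (dist (P x) (P y) / 2)"
    have PC: "P x \<in> C" "P y \<in> C" using P unfolding nearest_point_map_def by auto
    have "m' \<in> C" unfolding m'_def using geo_convexD[OF C PC g'] by simp
    then have "dist m (P m) \<le> dist m m'" using P unfolding nearest_point_map_def by blast
    also have "\<dots> \<le> \<delta>"
    proof (rule power2_le_imp_le)
      have "(dist m m')\<^sup>2 \<le> ((dist x (P x))\<^sup>2 + (dist y (P y))\<^sup>2) / 2"
        unfolding m_def m'_def by (rule CAT_midpoints_dist[OF q Y g g'])
      also have "\<dots> \<le> (\<delta>\<^sup>2 + \<delta>\<^sup>2) / 2" using x y by (intro divide_right_mono add_mono power_mono) auto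
      finally show "(dist m m')\<^sup>2 \<le> \<delta>\<^sup>2" by simp
      show "0 \<le> \<delta>" using x order_trans[OF zero_le_dist[of x "P x"]] by blast
    qed
    finally show "\<gamma> (dist x y / 2) \<in> {y. dist y (P y) \<le> \<delta>}" by (simp add: m_def)
  qed
qed

section \<open>Geodesic hulls\<close>

lemma subset_G1: "C \<subseteq> G1 C"
proof
  fix x assume "x \<in> C"
  moreover have "geodesic (\<lambda>_. x) x x" by (simp add: geodesic_def)
  moreover have "x \<in> (\<lambda>_. x) ` {0..dist x x}" by simp
  ultimately show "x \<in> G1 C" unfolding G1_def by blast
qed

lemma G1_iterate_mono:
  assumes "m \<le> n"
  shows "(G1 ^^ m) C \<subseteq> (G1 ^^ n) C"
  using assms
proof (induction rule: dec_induct)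
  case (step n)
  then show ?case using subset_G1[of "(G1 ^^ n) C"] by (simp only: funpow.simps comp_apply)
qed (rule subset_refl)

lemma subset_geo_co: "C \<subseteq> geo_co C"
proof -
  have "(G1 ^^ Suc 0) C \<subseteq> geo_co C" unfolding geo_co_def by (rule UN_upper) simp
  then show ?thesis using subset_G1[of C] by (simp only: funpow.simps comp_apply id_apply)
qed

lemma geo_convex_geo_co: "geo_convex (geo_co C)"
  unfolding geo_convex_def
proof (intro ballI allI impI)
  fix x y \<gamma> assume x: "x \<in> geo_co C" and y: "y \<in> geo_co C" and g: "geodesic \<gamma> x y"
  obtain m n where "x \<in> (G1 ^^ Suc m) C" "y \<in> (G1 ^^ Suc n) C" using x y unfolding geo_co_def by blast
  then have "x \<in> (G1 ^^ Suc (max m n)) C" "y \<in> (G1 ^^ Suc (max m n)) C"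
    using G1_iterate_mono[of "Suc m" "Suc (max m n)"] G1_iterate_mono[of "Suc n" "Suc (max m n)"] by auto
  then have "\<gamma> ` {0..dist x y} \<subseteq> G1 ((G1 ^^ Suc (max m n)) C)" unfolding G1_def using g by blast
  then have "\<gamma> ` {0..dist x y} \<subseteq> (G1 ^^ Suc (Suc (max m n))) C" by simp
  then show "\<gamma> ` {0..dist x y} \<subseteq> geo_co C" unfolding geo_co_def by blast
qed

lemma geo_co_minimal:
  assumes "geo_convex D" "C \<subseteq> D"
  shows "geo_co C \<subseteq> D"
proof -
  have "(G1 ^^ n) C \<subseteq> D" for n
  proof (induction n)
    case (Suc n)
    then show ?case using geo_convexD'[OF assms(1)] by (fastforce simp: G1_def)
  qed (use assms in simp)
  then show ?thesis unfolding geo_co_def by blast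
qed

text \<open>\<open>\<eta> = md q h\<close> makes \<open>t + \<eta> + q * \<eta> * t\<close>, for \<open>t = md q (dist x z)\<close>, the \<open>md\<close> of the
  distance from \<open>x\<close> to the copy of \<open>z\<close> at height \<open>h\<close> over \<open>X\<close> (in \<open>X \<times> \<real>\<close> if \<open>q = 0\<close>, in the warped
  product with factor \<open>cosh\<close> otherwise). There \<open>G\<close> extends the map \<open>g\<close> on the base and \<open>F\<close> on the
  upper copy.\<close>

theorem layered_extension:
  fixes g F :: "'a::metric_space \<Rightarrow> 'b::complete_space"
  assumes q: "q \<ge> 0" and X: "CBB (- q) (UNIV :: 'a set)" and Y: "CAT (- q) (UNIV :: 'b set)"
    and C: "geo_convex C" "closed C" and \<eta>: "\<eta> \<ge> 0"
    and F: "\<And>x. F x \<in> C" "\<And>x y. dist (F x) (F y) \<le> dist x y"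
    and g: "\<And>a. a \<in> A \<Longrightarrow> g a \<in> C" "\<And>a b. a \<in> A \<Longrightarrow> b \<in> A \<Longrightarrow> dist (g a) (g b) \<le> dist a b"
    and gF: "\<And>a z. a \<in> A \<Longrightarrow> md q (dist (g a) (F z)) \<le> md q (dist a z) + \<eta> + q * \<eta> * md q (dist a z)"
  obtains G where "\<And>x. G x \<in> C" "\<And>x y. dist (G x) (G y) \<le> dist x y" "\<And>a. a \<in> A \<Longrightarrow> G a = g a"
    "\<And>x z. md q (dist (G x) (F z)) \<le> md q (dist x z) + \<eta> + q * \<eta> * md q (dist x z)"
proof -
  define lift where "lift t = t + \<eta> + q * \<eta> * t" for t
  \<comment> \<open>Partial extensions are relations, so unions of chains are immediate;
    nonexpansiveness makes them single-valued.\<close>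
  define good where "good R \<longleftrightarrow> (\<forall>(x, y)\<in>R. y \<in> C \<and> (\<forall>z. md q (dist y (F z)) \<le> lift (md q (dist x z)))) \<and>
    (\<forall>(x, y)\<in>R. \<forall>(x', y')\<in>R. dist y y' \<le> dist x x')" for R :: "('a \<times> 'b) set"
  define \<A> where "\<A> = {R. (\<lambda>a. (a, g a)) ` A \<subseteq> R \<and> good R}"
  have "(\<lambda>a. (a, g a)) ` A \<in> \<A>" unfolding \<A>_def good_def using g gF by (auto simp: lift_def)
  then have "\<A> \<noteq> {}" by blast
  moreover have "\<Union>\<C> \<in> \<A>" if "\<C> \<noteq> {}" "subset.chain \<A> \<C>" for \<C>
  proof -
    have sub: "\<C> \<subseteq> \<A>" and tot: "\<And>R S. R \<in> \<C> \<Longrightarrow> S \<in> \<C> \<Longrightarrow> R \<subseteq> S \<or> S \<subseteq> R"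
      using that(2) unfolding subset_chain_def by blast+
    have "(\<lambda>a. (a, g a)) ` A \<subseteq> \<Union>\<C>" using that(1) sub unfolding \<A>_def by blast
    moreover have "good (\<Union>\<C>)"
      unfolding good_def
    proof (intro conjI ballI)
      fix i assume "i \<in> \<Union>\<C>"
      then obtain R where "R \<in> \<C>" "i \<in> R" by blast
      then show "case i of (x, y) \<Rightarrow> y \<in> C \<and> (\<forall>z. md q (dist y (F z)) \<le> lift (md q (dist x z)))"
        using sub unfolding \<A>_def good_def by blast
    next
      fix i assume "i \<in> \<Union>\<C>"
      then obtain R where R: "R \<in> \<C>" "i \<in> R" by blast
      show "case i of (x, y) \<Rightarrow> \<forall>(x', y')\<in>\<Union>\<C>. dist y y' \<le> dist x x'"
      proof (clarify)
        fix x y x' y' S assume i: "i = (x, y)" and S: "(x', y') \<in> S" "S \<in> \<C>"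
        obtain T where "T \<in> \<C>" "(x, y) \<in> T" "(x', y') \<in> T" using tot[OF R(1) S(2)] R S i by blast
        then show "dist y y' \<le> dist x x'" using sub unfolding \<A>_def good_def by blast
      qed
    qed
    ultimately show ?thesis unfolding \<A>_def by blast
  qed
  ultimately obtain M where M: "M \<in> \<A>" "\<And>R. R \<in> \<A> \<Longrightarrow> M \<subseteq> R \<Longrightarrow> R = M"
    using subset_Zorn_nonempty[of \<A>] by blast
  have MC: "\<And>u v. (u, v) \<in> M \<Longrightarrow> v \<in> C"
    and MF: "\<And>u v z. (u, v) \<in> M \<Longrightarrow> md q (dist v (F z)) \<le> lift (md q (dist u z))"
    and MM: "\<And>u v u' v'. (u, v) \<in> M \<Longrightarrow> (u', v') \<in> M \<Longrightarrow> dist v v' \<le> dist u u'"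
    using M(1) unfolding \<A>_def good_def by blast+
  have "\<exists>y. (x, y) \<in> M" for x
  proof -
    \<comment> \<open>The Boolean marks the upper layer. Constraints from all points of the copy are
      imposed together with those from the maximal relation.\<close>
    define J where "J = {(u, v, False) | u v. (u, v) \<in> M} \<union> {(u, F u, True) | u. True}"
    define p where "p = (\<lambda>(u :: 'a, v :: 'b, b :: bool). v)"
    define E where "E = (\<lambda>(u :: 'a, v :: 'b, b :: bool). md q (dist x u))"
    define s where "s = (\<lambda>(u :: 'a, v :: 'b, b :: bool). if b then 1 else (0 :: real))"
    \<comment> \<open>With \<open>s\<close> marking the layer, \<open>h i\<close> is the warping
      factor, the generalised cosine of the height, and \<open>e i\<close> is \<open>md\<close> of
      the distance from \<open>x\<close> on the base to the point \<open>i\<close>.\<close>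
    define h where "h i = 1 + q * \<eta> * s i" for i
    define e where "e i = h i * E i + \<eta> * s i" for i
    have s: "0 \<le> s i" "s i \<le> 1" for i by (auto simp: s_def split: prod.splits)
    have h1: "h i \<ge> 1" for i unfolding h_def using q \<eta> s by simp
    have E0: "E i \<ge> 0" for i using q by (auto simp: E_def md_nonneg split: prod.splits)
    \<comment> \<open>The right-hand side is \<open>md\<close> of the distance in the warped
      product, written uniformly for the four combinations of layers.\<close>
    have pw: "md q (dist (p i) (p j)) \<le> h i * h j * md q (dist (fst i) (fst j)) + \<eta> * (s i * (1 - s j) + s j * (1 - s i))"
      if ij: "i \<in> J" "j \<in> J" for i j
    proof -
      obtain u v b u' v' b' where i: "i = (u, v, b)" and j: "j = (u', v', b')" by (metis prod_cases3)
      have md0: "md q (dist u u') \<ge> 0" using q by (rule md_nonneg)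
      consider "\<not> b" "\<not> b'" "(u, v) \<in> M" "(u', v') \<in> M" | "\<not> b" "b'" "(u, v) \<in> M" "v' = F u'"
        | "b" "\<not> b'" "v = F u" "(u', v') \<in> M" | "b" "b'" "v = F u" "v' = F u'"
        using ij unfolding i j J_def by blast
      then show ?thesis
      proof cases
        case 1
        then have "md q (dist v v') \<le> md q (dist u u')" using MM q by (intro md_mono) auto
        then show ?thesis using 1 by (simp add: i j p_def s_def h_def)
      next
        case 2
        then show ?thesis using MF[of u v u'] by (simp add: i j p_def s_def h_def lift_def algebra_simps)
      next
        case 3
        then show ?thesis using MF[of u' v' u] by (simp add: i j p_def s_def h_def lift_def dist_commute algebra_simps)
      next
        case 4
        then have "md q (dist v v') \<le> 1 * 1 * md q (dist u u')" using F(2) q by (auto intro!: md_mono)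
        also have "\<dots> \<le> h i * h j * md q (dist u u')" using h1[of i] h1[of j] md0 by (intro mult_mono) auto
        finally show ?thesis using 4 by (simp add: i j p_def s_def)
      qed
    qed
    have "\<exists>y\<in>C. \<forall>i\<in>J. md q (dist y (p i)) \<le> e i"
    proof (rule CAT_ball_intersection[OF q Y C])
      show "C \<noteq> {}" using F(1) by blast
      show "p i \<in> C" if "i \<in> J" for i using that MC F(1) by (auto simp: J_def p_def)
      show "e i \<ge> 0" if "i \<in> J" for i
        unfolding e_def using h1[of i] E0[of i] s(1)[of i] \<eta> by simp
    next
      fix S c assume S: "finite S" "S \<subseteq> J" and c: "\<And>i. i \<in> S \<Longrightarrow> (0::real) \<le> c i" and c1: "sum c S = 1"
      define U where "U = (\<Sum>i\<in>S. c i * h i * E i)"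
      define \<sigma> where "\<sigma> = (\<Sum>i\<in>S. c i * s i)"
      have H: "(\<Sum>i\<in>S. c i * h i) = 1 + q * \<eta> * \<sigma>"
        using c1 by (simp add: h_def \<sigma>_def distrib_left sum.distrib sum_distrib_left mult_ac)
      have R: "(\<Sum>i\<in>S. c i * e i) = U + \<eta> * \<sigma>"
        by (simp add: e_def U_def \<sigma>_def distrib_left sum.distrib sum_distrib_left mult_ac)
      define D where "D = (\<Sum>i\<in>S. \<Sum>j\<in>S. (c i * h i) * (c j * h j) * md q (dist (fst i) (fst j)))"
      \<comment> \<open>The warping factors are absorbed in the weights, so the inequality is
        applied to the base points in \<open>X\<close> alone.\<close>
      have "0 \<le> (\<Sum>i\<in>S. \<Sum>j\<in>S. (c i * h i) * (c j * h j) * apex q x (fst i) (fst j))"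
        using c h1 by (intro CBB_apex_nonneg[OF q X S(1)]) (meson mult_nonneg_nonneg order_trans zero_le_one)
      also have "\<dots> = (\<Sum>i\<in>S. \<Sum>j\<in>S. (c i * h i * E i) * (c j * h j) + (c i * h i) * (c j * h j * E j)
          + q * ((c i * h i * E i) * (c j * h j * E j)) - (c i * h i) * (c j * h j) * md q (dist (fst i) (fst j)))"
        by (intro sum.cong) (auto simp: apex_def E_def algebra_simps)
      also have "\<dots> = 2 * (1 + q * \<eta> * \<sigma>) * U + q * U\<^sup>2 - D"
        unfolding sum.distrib sum_subtractf D_def[symmetric] sum_distrib_left[symmetric] sum_distrib_right[symmetric]
          H U_def[symmetric] by (simp add: power2_eq_square algebra_simps)
      finally have D: "D \<le> 2 * (1 + q * \<eta> * \<sigma>) * U + q * U\<^sup>2" by simp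
      have "(\<Sum>i\<in>S. \<Sum>j\<in>S. c i * c j * md q (dist (p i) (p j)))
         \<le> (\<Sum>i\<in>S. \<Sum>j\<in>S. c i * c j * (h i * h j * md q (dist (fst i) (fst j)) + \<eta> * (s i * (1 - s j) + s j * (1 - s i))))"
        using S c by (intro sum_mono mult_left_mono pw) auto
      also have "\<dots> = (\<Sum>i\<in>S. \<Sum>j\<in>S. (c i * h i) * (c j * h j) * md q (dist (fst i) (fst j))
          + \<eta> * ((c i * s i) * c j + c i * (c j * s j) - 2 * ((c i * s i) * (c j * s j))))"
        by (intro sum.cong) (auto simp: algebra_simps)
      also have "\<dots> = D + \<eta> * (2 * \<sigma> - 2 * (\<sigma> * \<sigma>))"
        unfolding sum.distrib sum_subtractf D_def[symmetric] sum_distrib_left[symmetric] sum_distrib_right[symmetric]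
          \<sigma>_def[symmetric] c1 by simp
      also have "\<dots> \<le> 2 * (U + \<eta> * \<sigma>) + q * (U + \<eta> * \<sigma>)\<^sup>2"
      proof -
        have "0 \<le> \<eta> * (\<sigma> * \<sigma>)" "0 \<le> q * (\<eta> * \<sigma>)\<^sup>2" using \<eta> q by simp_all
        then show ?thesis using D by (simp add: power2_eq_square algebra_simps)
      qed
      finally show "(\<Sum>i\<in>S. \<Sum>j\<in>S. c i * c j * md q (dist (p i) (p j)))
          \<le> 2 * (\<Sum>i\<in>S. c i * e i) + q * (\<Sum>i\<in>S. c i * e i)\<^sup>2" unfolding R .
    qed
    then obtain y where y: "y \<in> C" "\<And>i. i \<in> J \<Longrightarrow> md q (dist y (p i)) \<le> e i" by blast
    have yM: "dist y v \<le> dist x u" if "(u, v) \<in> M" for u v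
    proof -
      have "(u, v, False) \<in> J" using that by (auto simp: J_def)
      then have "md q (dist y v) \<le> md q (dist x u)"
        using y(2) by (fastforce simp: p_def e_def h_def s_def E_def)
      then show ?thesis using md_le_iff[OF q] by simp
    qed
    have yF: "md q (dist y (F z)) \<le> lift (md q (dist x z))" for z
    proof -
      have "(z, F z, True) \<in> J" by (auto simp: J_def)
      from y(2)[OF this] show ?thesis
        by (simp add: p_def e_def h_def s_def E_def lift_def algebra_simps)
    qed
    have "good (insert (x, y) M)"
      unfolding good_def using y(1) yM yF MC MF MM by (auto simp: dist_commute)
    then have "insert (x, y) M \<in> \<A>" using M(1) unfolding \<A>_def by blast
    then show ?thesis using M(2)[of "insert (x, y) M"] by blast
  qed
  then obtain G where G: "\<And>x. (x, G x) \<in> M" by metis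
  show ?thesis
  proof (rule that)
    show "G x \<in> C" for x using MC G by blast
    show "dist (G x) (G y) \<le> dist x y" for x y using MM G by blast
    show "G a = g a" if "a \<in> A" for a
    proof -
      have "(a, g a) \<in> M" using M(1) that unfolding \<A>_def by blast
      then have "dist (G a) (g a) \<le> dist a a" using MM G by blast
      then show ?thesis by simp
    qed
    show "md q (dist (G x) (F z)) \<le> md q (dist x z) + \<eta> + q * \<eta> * md q (dist x z)" for x z
      using MF[OF G] by (simp add: lift_def)
  qed
qed

theorem theorem4p6:
  fixes \<kappa> :: real and A :: "'a::metric_space set"
  assumes "\<kappa> \<le> 0"
    and "CBB \<kappa> (UNIV :: 'a set)"
    and "CAT \<kappa> (UNIV :: 'b::complete_space set)"
    and "A \<noteq> {}"
  shows "lsc_multimap (N_open A) (N_open (UNIV :: 'a set)) (nonexp_maps A)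
           (Phi_c A :: ('a \<Rightarrow> 'b) \<Rightarrow> ('a \<Rightarrow> 'b) set)"
  unfolding lsc_multimap_def
proof (intro allI impI)
  fix V :: "('a \<Rightarrow> 'b) set" assume V: "N_open UNIV V"
  define q where "q = - \<kappa>"
  have q: "q \<ge> 0" and X: "CBB (- q) (UNIV :: 'a set)" and Y: "CAT (- q) (UNIV :: 'b set)"
    using assms by (simp_all add: q_def)
  have stable: "\<exists>\<delta>>0. \<forall>g\<in>nonexp_maps A. sup_dist A f g < \<delta> \<longrightarrow> Phi_c A g \<inter> V \<noteq> {}"
    if f: "f \<in> nonexp_maps A" and ne: "Phi_c A f \<inter> V \<noteq> {}" for f :: "'a \<Rightarrow> 'b"
  proof -
    obtain F where F: "F \<in> Phi_c A f" "F \<in> V" using ne by blast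
    obtain e where e: "e > 0" "\<And>G. G \<in> nonexp_maps UNIV \<Longrightarrow> sup_dist UNIV F G < e \<Longrightarrow> G \<in> V"
      using V F(2) unfolding N_open_def by meson
    have Fne: "dist (F x) (F y) \<le> dist x y" and Fb: "bounded (range F)"
      and Ff: "a \<in> A \<Longrightarrow> F a = f a" and Fc: "F x \<in> closure (geo_co (f ` A))" for x y a
      using F(1) unfolding Phi_c_def nonexp_maps_def by auto
    obtain B where B: "\<And>x y. dist (F x) (F y) \<le> B"
      using Fb unfolding bounded_two_points by blast
    have B0: "B \<ge> 0" using B[of undefined undefined] by simp
    \<comment> \<open>One \<open>h\<close> is spent on the projection and one on the height between
      the layers; the third makes the final inequality strict.\<close>
    define h where "h = e / 3"
    define \<eta> where "\<eta> = md q h"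
    have h: "h > 0" using e by (simp add: h_def)
    have \<eta>: "\<eta> > 0" using md_strict_mono[OF q, of 0 h] h by (simp add: \<eta>_def)
    have "uniformly_continuous_on {0..B + 1} (md q)"
      by (intro compact_uniformly_continuous continuous_on_md[OF continuous_on_id]) auto
    then obtain d where d: "d > 0" "\<And>s t. s \<in> {0..B + 1} \<Longrightarrow> t \<in> {0..B + 1} \<Longrightarrow> dist t s < d \<Longrightarrow> dist (md q t) (md q s) < \<eta>"
      unfolding uniformly_continuous_on_def using \<eta> by meson
    \<comment> \<open>The bound \<open>h\<close> limits the displacement by the projection, 1 keeps
      the arguments of \<open>md\<close> inside the compact interval, and \<open>d / 2\<close> gives
      the strict bound for uniform continuity.\<close>
    define \<delta> where "\<delta> = min (min h 1) (d / 2)"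
    have \<delta>: "\<delta> > 0" "\<delta> \<le> h" "\<delta> \<le> 1" "\<delta> < d" using h d(1) by (auto simp: \<delta>_def)
    show ?thesis
    proof (intro exI conjI ballI impI)
      show "\<delta> > 0" by (rule \<delta>(1))
      fix g assume g: "g \<in> nonexp_maps A" and fg: "sup_dist A f g < \<delta>"
      have gne: "a \<in> A \<Longrightarrow> b \<in> A \<Longrightarrow> dist (g a) (g b) \<le> dist a b" for a b
        using g unfolding nonexp_maps_def by auto
      have near: "dist (f a) (g a) \<le> \<delta>" if a: "a \<in> A" for a
      proof -
        have "bounded (f ` A)" "bounded (g ` A)" using f g unfolding nonexp_maps_def by auto
        then have "bounded (f ` A \<union> g ` A)" by simp
        then obtain K where "\<And>u v. u \<in> f ` A \<union> g ` A \<Longrightarrow> v \<in> f ` A \<union> g ` A \<Longrightarrow> dist u v \<le> K"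
          unfolding bounded_two_points by blast
        then have "bdd_above ((\<lambda>x. dist (f x) (g x)) ` A)" by (intro bdd_aboveI2) auto
        then have "dist (f a) (g a) \<le> sup_dist A f g"
          unfolding sup_dist_def using a by (intro cSUP_upper)
        then show ?thesis using fg by simp
      qed
      define C where "C = closure (geo_co (g ` A))"
      have C: "geo_convex C" "closed C"
        unfolding C_def using geo_convex_closure[OF q Y geo_convex_geo_co] by auto
      have gC: "g a \<in> C" if "a \<in> A" for a
        using subset_geo_co[of "g ` A"] closure_subset that unfolding C_def by blast
      then have "C \<noteq> {}" using assms(4) by blast
      then obtain P where P: "nearest_point_map C P" using nearest_point_map_exists[OF q Y C] by blast
      note Pne = nearest_point_map_nonexpansive[OF q Y C(1) P]
      define N where "N = {y. dist y (P y) \<le> \<delta>}"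
      have "f ` A \<subseteq> N"
      proof
        fix y assume "y \<in> f ` A"
        then obtain a where a: "a \<in> A" "y = f a" by blast
        have "dist y (P y) \<le> dist y (g a)" using P gC[OF a(1)] unfolding nearest_point_map_def by blast
        then show "y \<in> N" using near[OF a(1)] a(2) by (simp add: N_def)
      qed
      then have "geo_co (f ` A) \<subseteq> N"
        using geo_co_minimal geo_convex_neighbourhood(2)[OF q Y C(1) P] unfolding N_def by blast
      then have "closure (geo_co (f ` A)) \<subseteq> N"
        using closure_minimal geo_convex_neighbourhood(1)[OF q Y C(1) P] unfolding N_def by blast
      then have FP: "dist (F x) (P (F x)) \<le> \<delta>" for x using Fc[of x] by (auto simp: N_def)
      obtain G where G: "\<And>x. G x \<in> C" "\<And>x y. dist (G x) (G y) \<le> dist x y" "\<And>a. a \<in> A \<Longrightarrow> G a = g a"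
        "\<And>x z. md q (dist (G x) (P (F z))) \<le> md q (dist x z) + \<eta> + q * \<eta> * md q (dist x z)"
      proof (rule layered_extension[OF q X Y C less_imp_le[OF \<eta>], of "\<lambda>x. P (F x)" A g])
        show "P (F x) \<in> C" for x using P unfolding nearest_point_map_def by blast
        show "dist (P (F x)) (P (F y)) \<le> dist x y" for x y using Pne Fne by (rule order_trans)
        show "md q (dist (g a) (P (F z))) \<le> md q (dist a z) + \<eta> + q * \<eta> * md q (dist a z)" if a: "a \<in> A" for a z
        proof -
          have "dist (g a) (P (g a)) \<le> dist (g a) (g a)"
            using P gC[OF a] unfolding nearest_point_map_def by blast
          then have "P (g a) = g a" by simp
          then have "dist (g a) (P (F z)) \<le> dist (g a) (F z)" using Pne[of "g a" "F z"] by simp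
          also have "\<dots> \<le> dist (f a) (g a) + dist (F a) (F z)"
            using dist_triangle3[of "g a" "F z" "f a"] Ff[OF a] by simp
          \<comment> \<open>The minimum with \<open>B\<close> is essential: \<open>md\<close> is not
            uniformly continuous on the half-line, and \<open>dist a z\<close> may be arbitrarily
            large. Beyond \<open>B\<close> the boundedness of \<open>F\<close> takes over.\<close>
          also have "\<dots> \<le> \<delta> + min (dist a z) B" using near[OF a] Fne B by (intro add_mono) auto
          finally have "md q (dist (g a) (P (F z))) \<le> md q (\<delta> + min (dist a z) B)"
            using q by (intro md_mono) auto
          also have "\<dots> \<le> md q (min (dist a z) B) + \<eta>"
          proof -
            have "0 \<le> min (dist a z) B" "min (dist a z) B \<le> B" using B0 by auto
            then have "dist (md q (\<delta> + min (dist a z) B)) (md q (min (dist a z) B)) < \<eta>"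
              using \<delta> by (intro d(2)) (auto simp: dist_real_def)
            then show ?thesis unfolding dist_real_def by linarith
          qed
          also have "md q (min (dist a z) B) \<le> md q (dist a z)" using B0 q by (intro md_mono) auto
          also have "md q (dist a z) + \<eta> \<le> md q (dist a z) + \<eta> + q * \<eta> * md q (dist a z)"
            using q \<eta> by (simp add: md_nonneg)
          finally show ?thesis by simp
        qed
      qed (use gC gne in auto)
      have FG: "dist (F x) (G x) \<le> 2 * h" for x
      proof -
        have "md q (dist (G x) (P (F x))) \<le> md q h" using G(4)[of x x] by (simp add: \<eta>_def)
        then have "dist (G x) (P (F x)) \<le> h" using md_le_iff[OF q] h by simp
        then show ?thesis using dist_triangle2[of "F x" "G x" "P (F x)"] FP[of x] \<delta>(2) by simp
      qed
      have "bounded (range G)"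
        unfolding bounded_two_points
      proof (intro exI ballI)
        fix u v assume "u \<in> range G" "v \<in> range G"
        then obtain x y where "u = G x" "v = G y" by blast
        moreover have "dist (G x) (G y) \<le> dist (F x) (G x) + dist (F x) (F y) + dist (F y) (G y)" by metric
        ultimately show "dist u v \<le> 2 * h + B + 2 * h" using FG[of x] FG[of y] B[of x y] by simp
      qed
      then have Gne: "G \<in> nonexp_maps UNIV" unfolding nonexp_maps_def using G(2) by simp
      have "sup_dist UNIV F G \<le> 2 * h" unfolding sup_dist_def using FG by (intro cSUP_least) auto
      also have "2 * h < e" using e(1) by (simp add: h_def)
      finally have "G \<in> V" using e(2) Gne by blast
      moreover have "G \<in> Phi_c A g"
        unfolding Phi_c_def using Gne G(1,3) by (auto simp: C_def)
      ultimately show "Phi_c A g \<inter> V \<noteq> {}" by blast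
    qed
  qed
  show "N_open A {u \<in> nonexp_maps A. Phi_c A u \<inter> V \<noteq> {}}"
    unfolding N_open_def
  proof (intro conjI ballI)
    fix f assume "f \<in> {u \<in> nonexp_maps A. Phi_c A u \<inter> V \<noteq> {}}"
    then have "f \<in> nonexp_maps A" "Phi_c A f \<inter> V \<noteq> {}" by simp_all
    from stable[OF this] show "\<exists>e>0. \<forall>g\<in>nonexp_maps A. sup_dist A f g < e \<longrightarrow>
        g \<in> {u \<in> nonexp_maps A. Phi_c A u \<inter> V \<noteq> {}}" by simp
  qed auto
qed

end
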